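(* Let $c\in\{-1,+1\}$, let $f\in C^1(\mathbb{R},\mathbb{R})$ with $f'>0$ on $\mathbb{R}$ and $f(0)=0$, and let $g:\mathbb{R}\to\mathbb{R}$ be differentiable. Assume there is a constant $\gamma$ with $0\le\gamma<1$ such that $|g|\le\gamma|f|$ and $|g'|\le\gamma|f'|$ on $\mathbb{R}$, and assume $\lim_{y\to\pm\infty}f(y)=\pm\infty$. Let $T>0$ be such that $nT=1$ for some integer $n\ge1$, and let $s\in H^1_\sharp$. Then there exists a unique $T$-periodic solution $y\in H^1_\sharp$ of $$y'(t)+c\,y'(t-1)+f(y(t))+g(y(t-1))=s(t),$$ and it satisfies the non-autonomous differential equation $$(1+c)\,y'(t)+f(y(t))+g(y(t))=s(t).$$ Furthermore, if $c=1$, the same holds for every source $s\in L^2_\sharp$.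
   Context: $L^2_\sharp$ denotes the space of real $T$-periodic functions on $\mathbb{R}$ that are square-integrable over a period, and $H^1_\sharp$ the Sobolev space of $T$-periodic functions in $L^2_\sharp$ whose (weak) derivative is in $L^2_\sharp$. The equations are understood for almost every $t\in\mathbb{R}$. *)

theory Defs
  imports "HOL-Analysis.Analysis"
begin

definition test_function :: "(real \<Rightarrow> real) \<Rightarrow> bool" where
  "test_function \<phi> \<longleftrightarrow>
     (\<forall>k x. (deriv ^^ k) \<phi> field_differentiable (at x)) \<and> compact (closure {x. \<phi> x \<noteq> 0})"

definition locally_integrable :: "(real \<Rightarrow> real) \<Rightarrow> bool" where
  "locally_integrable u \<longleftrightarrow> (\<forall>a b. set_integrable lebesgue {a..b} u)"

definition has_weak_deriv :: "(real \<Rightarrow> real) \<Rightarrow> (real \<Rightarrow> real) \<Rightarrow> bool" where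
  "has_weak_deriv u v \<longleftrightarrow>
     locally_integrable u \<and> locally_integrable v \<and>
     (\<forall>\<phi>. test_function \<phi> \<longrightarrow>
        (LINT t|lebesgue. u t * deriv \<phi> t) = - (LINT t|lebesgue. v t * \<phi> t))"

(* Weak derivatives are unique only up to null sets, so statements about weak_deriv u
   are meaningful only almost everywhere. *)
definition weak_deriv :: "(real \<Rightarrow> real) \<Rightarrow> real \<Rightarrow> real" where
  "weak_deriv u = (SOME v. has_weak_deriv u v)"

(* The sets L2_per T and H1_per T consist of representatives; equality of elements of the
   corresponding function spaces is equality almost everywhere. *)
definition L2_per :: "real \<Rightarrow> (real \<Rightarrow> real) set" where
  "L2_per T = {u. (\<forall>t. u (t + T) = u t) \<and> u \<in> borel_measurable lebesgue \<and>
                  set_integrable lebesgue {0..T} (\<lambda>t. (u t)\<^sup>2)}"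

definition H1_per :: "real \<Rightarrow> (real \<Rightarrow> real) set" where
  "H1_per T = {u \<in> L2_per T. \<exists>v \<in> L2_per T. has_weak_deriv u v}"

definition solves_delay ::
  "real \<Rightarrow> (real \<Rightarrow> real) \<Rightarrow> (real \<Rightarrow> real) \<Rightarrow> (real \<Rightarrow> real) \<Rightarrow> (real \<Rightarrow> real) \<Rightarrow> bool" where
  "solves_delay c f g s y \<longleftrightarrow>
     (AE t in lebesgue.
        weak_deriv y t + c * weak_deriv y (t - 1) + f (y t) + g (y (t - 1)) = s t)"

definition solves_ode ::
  "real \<Rightarrow> (real \<Rightarrow> real) \<Rightarrow> (real \<Rightarrow> real) \<Rightarrow> (real \<Rightarrow> real) \<Rightarrow> (real \<Rightarrow> real) \<Rightarrow> bool" where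
  "solves_ode c f g s y \<longleftrightarrow>
     (AE t in lebesgue. (1 + c) * weak_deriv y t + f (y t) + g (y t) = s t)"

end

theory Submission
  imports Defs
begin

text \<open>
  By \<open>T\<close>-periodicity and \<open>n T = 1\<close> the delay disappears, so the equation is
  \<open>(1 + c) y' + h y = s\<close> with \<open>h = f + g\<close>, an increasing bijection whose slopes are positive and
  bounded on compact sets.

  For \<open>c = -1\<close> the solution is \<open>y = h\<^sup>-\<^sup>1 \<circ> s\<close>, and the point is that it lies in \<open>H\<^sup>1\<close>: the inverse is
  locally Lipschitz and differentiable, though not \<open>C\<^sup>1\<close>, so the chain rule is obtained as a limit of
  \<open>C\<^sup>1\<close> chain rules.

  For \<open>c = 1\<close> let \<open>S\<close> be a primitive of half of \<open>s\<close> minus its mean \<open>h m\<close>. Then \<open>u = y - S\<close> solves the classical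
  equation \<open>u' = (h m - h (u + S)) / 2\<close>, which is a contraction after adding \<open>L u\<close> to both sides and
  inverting \<open>d/dt + L\<close> on periodic functions. Uniqueness follows by multiplying the difference of
  two equations by the difference of the solutions and integrating over a period.
\<close>

section \<open>Primitives of locally integrable functions\<close>

text \<open>The statement speaks of weak derivatives and equality almost everywhere, while the
  arguments are pointwise. The link is \<open>is_primitive u v\<close>: local absolute continuity of
  \<open>u\<close> with derivative \<open>v\<close>, where absolute integrability is demanded
  separately because \<open>has_integral\<close> is the Henstock-Kurzweil integral. Such a
  \<open>u\<close> has weak derivative \<open>v\<close>; conversely a function with weak derivative
  \<open>v\<close> agrees almost everywhere with such a \<open>u\<close>, so each element of
  \<open>H1_per T\<close> has a continuous periodic representative on which the calculus takes
  place.

  The two values of \<open>c\<close> ask for different regularity of the source. For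
  \<open>c = 1\<close> the primitive \<open>S\<close> absorbs the only possibly discontinuous term,
  so what remains has a continuous right-hand side and a square-integrable source suffices. For
  \<open>c = -1\<close> nothing is integrated: a weak derivative of \<open>s\<close> has to be
  carried through the inverse of \<open>h\<close>.\<close>

definition is_primitive :: "(real \<Rightarrow> real) \<Rightarrow> (real \<Rightarrow> real) \<Rightarrow> bool" where
  "is_primitive u v \<longleftrightarrow>
     (\<forall>a b. v absolutely_integrable_on {a..b}) \<and>
     (\<forall>a b. a \<le> b \<longrightarrow> (v has_integral (u b - u a)) {a..b})"

lemma is_primitive_absolutely_integrable:
  "is_primitive u v \<Longrightarrow> v absolutely_integrable_on {a..b}"
  by (simp add: is_primitive_def)

lemma is_primitive_has_integral:
  "is_primitive u v \<Longrightarrow> a \<le> b \<Longrightarrow> (v has_integral (u b - u a)) {a..b}"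
  by (simp add: is_primitive_def)

lemma is_primitive_continuous:
  assumes "is_primitive u v"
  shows "continuous_on S u"
proof -
  have "isCont u x" for x
  proof -
    have "v integrable_on {x-1..x+1}"
      using is_primitive_absolutely_integrable[OF assms, of "x-1" "x+1"]
      by (simp add: absolutely_integrable_on_def)
    then have "continuous_on {x-1..x+1} (\<lambda>t. u (x-1) + integral {x-1..t} v)"
      by (intro continuous_intros indefinite_integral_continuous_1)
    then have "continuous_on {x-1..x+1} u"
    proof (rule continuous_on_eq)
      fix t assume "t \<in> {x-1..x+1}"
      then show "u (x-1) + integral {x-1..t} v = u t"
        using is_primitive_has_integral[OF assms, of "x-1" t] by (simp add: integral_unique)
    qed
    then show ?thesis
      by (rule continuous_on_interior) simp
  qed
  then show ?thesis
    by (simp add: continuous_at_imp_continuous_on)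
qed

lemma C1_is_primitive:
  assumes "\<And>x. (G has_real_derivative G' x) (at x)" and "continuous_on UNIV G'"
  shows "is_primitive G G'"
  unfolding is_primitive_def
proof (intro conjI allI impI)
  fix a b :: real
  show "G' absolutely_integrable_on {a..b}"
    by (rule absolutely_integrable_continuous_real[OF continuous_on_subset[OF assms(2) subset_UNIV]])
  show "(G' has_integral (G b - G a)) {a..b}" if "a \<le> b"
    using that assms(1)
    by (intro fundamental_theorem_of_calculus)
       (auto simp: has_real_derivative_iff_has_vector_derivative has_vector_derivative_at_within)
qed

lemma is_primitive_add:
  assumes "is_primitive u v" "is_primitive w z"
  shows "is_primitive (\<lambda>t. u t + w t) (\<lambda>t. v t + z t)"
  unfolding is_primitive_def
proof (intro conjI allI impI)
  fix a b :: real
  show "(\<lambda>t. v t + z t) absolutely_integrable_on {a..b}"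
    using assms[THEN is_primitive_absolutely_integrable] by (rule set_integral_add)
  show "((\<lambda>t. v t + z t) has_integral (u b + w b - (u a + w a))) {a..b}" if "a \<le> b"
    using has_integral_add[OF assms[THEN is_primitive_has_integral[OF _ that]]] by (simp add: algebra_simps)
qed

lemma is_primitive_cmult:
  assumes "is_primitive u v"
  shows "is_primitive (\<lambda>t. k * u t) (\<lambda>t. k * v t)"
  unfolding is_primitive_def
proof (intro conjI allI impI)
  fix a b :: real
  show "(\<lambda>t. k * v t) absolutely_integrable_on {a..b}"
    using is_primitive_absolutely_integrable[OF assms] by simp
  show "((\<lambda>t. k * v t) has_integral (k * u b - k * u a)) {a..b}" if "a \<le> b"
    using has_integral_mult_right[OF is_primitive_has_integral[OF assms that], of k]
    by (simp add: algebra_simps)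
qed

lemma is_primitive_diff:
  assumes "is_primitive u v" "is_primitive w z"
  shows "is_primitive (\<lambda>t. u t - w t) (\<lambda>t. v t - z t)"
  using is_primitive_add[OF assms(1) is_primitive_cmult[OF assms(2), of "-1"]] by simp

section \<open>Chain and product rules for primitives\<close>

lemma absolutely_integrable_continuous_mult:
  fixes f v :: "real \<Rightarrow> real"
  assumes "continuous_on {a..b} f" "v absolutely_integrable_on {a..b}"
  shows "(\<lambda>x. f x * v x) absolutely_integrable_on {a..b}"
proof (rule absolutely_integrable_bounded_measurable_product_real)
  show "f \<in> borel_measurable (lebesgue_on {a..b})"
    using assms(1) by (simp add: continuous_imp_measurable_on_sets_lebesgue)
  show "bounded (f ` {a..b})"
    using assms(1) by (simp add: compact_continuous_image compact_imp_bounded)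
qed (use assms in auto)

text \<open>The mean value point lies between \<open>u x\<close> and \<open>u y\<close>, so the
  intermediate value theorem writes it as a value of \<open>u\<close>. Having it on the curve lets
  continuity of \<open>G'\<close> along \<open>u\<close> control it by the length of
  \<open>{x..y}\<close>.\<close>

lemma mean_value_along_curve:
  fixes G u :: "real \<Rightarrow> real"
  assumes G: "\<And>x. (G has_real_derivative G' x) (at x)"
    and u: "continuous_on {x..y} u" and "x \<le> y"
  shows "\<exists>\<tau>\<in>{x..y}. G (u y) - G (u x) = G' (u \<tau>) * (u y - u x)"
proof (cases "u x" "u y" rule: linorder_cases)
  case less
  then obtain z where z: "u x < z" "z < u y" "G (u y) - G (u x) = (u y - u x) * G' z"
    using MVT2[of "u x" "u y" G G'] G by auto
  then obtain \<tau> where "x \<le> \<tau>" "\<tau> \<le> y" "u \<tau> = z"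
    using IVT'[of u x z y] u \<open>x \<le> y\<close> by force
  with z show ?thesis by (auto simp: mult.commute)
next
  case equal
  with \<open>x \<le> y\<close> show ?thesis by auto
next
  case greater
  then obtain z where z: "u y < z" "z < u x" "G (u x) - G (u y) = (u x - u y) * G' z"
    using MVT2[of "u y" "u x" G G'] G by auto
  then obtain \<tau> where "x \<le> \<tau>" "\<tau> \<le> y" "u \<tau> = z"
    using IVT2'[of u y z x] u \<open>x \<le> y\<close> by force
  with z show ?thesis by (auto simp: algebra_simps intro!: bexI[of _ \<tau>])
qed

text \<open>On a short interval \<open>G' (u t)\<close> is nearly constant, so the mean value
  theorem gives the formula with an error of at most \<open>e\<close> times the integral of
  \<open>\<bar>v t\<bar>\<close>. Such errors add up when intervals are joined, so
  \<open>Bolzano\<close> carries the estimate to \<open>{a..b}\<close>, where \<open>e\<close> is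
  arbitrary.\<close>

lemma is_primitive_compose_C1:
  assumes uv: "is_primitive u v"
    and G: "\<And>x. (G has_real_derivative G' x) (at x)" and G': "continuous_on UNIV G'"
  shows "is_primitive (\<lambda>t. G (u t)) (\<lambda>t. G' (u t) * v t)"
proof -
  have cont: "continuous_on S (\<lambda>t. G' (u t))" for S
    using continuous_on_compose2[OF G' is_primitive_continuous[OF uv]] by auto
  have int: "(\<lambda>t. G' (u t) * v t) absolutely_integrable_on {a..b}" for a b
    by (intro absolutely_integrable_continuous_mult cont is_primitive_absolutely_integrable[OF uv])
  define w where "w = (\<lambda>t. G' (u t) * v t)"
  have wint: "w integrable_on {a..b}" for a b
    using int[of a b] by (simp add: w_def absolutely_integrable_on_def)
  have vabs: "(\<lambda>t. \<bar>v t\<bar>) integrable_on {a..b}" for a b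
    using is_primitive_absolutely_integrable[OF uv, of a b] by (simp add: absolutely_integrable_on_def)
  define P where "P e x y \<longleftrightarrow> \<bar>G (u y) - G (u x) - integral {x..y} w\<bar> \<le> e * integral {x..y} (\<lambda>t. \<bar>v t\<bar>)"
    for e x y
  have P: "P e a b" if "0 < e" "a \<le> b" for e a b
  proof (rule Bolzano[OF \<open>a \<le> b\<close>])
    fix x y z assume "P e x y" "P e y z" "x \<le> y" "y \<le> z"
    then show "P e x z"
      unfolding P_def
      using Henstock_Kurzweil_Integration.integral_combine[OF \<open>x \<le> y\<close> \<open>y \<le> z\<close> wint]
        Henstock_Kurzweil_Integration.integral_combine[OF \<open>x \<le> y\<close> \<open>y \<le> z\<close> vabs]
      by (simp flip: \<open>_ = integral {x..z} w\<close> \<open>_ = integral {x..z} (\<lambda>t. \<bar>v t\<bar>)\<close> add: distrib_left)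
  next
    fix s
    have "isCont (\<lambda>t. G' (u t)) s"
      using cont[of UNIV] by (simp add: continuous_on_eq_continuous_at)
    then obtain d where "0 < d" and d: "\<And>t. \<bar>t - s\<bar> < d \<Longrightarrow> \<bar>G' (u t) - G' (u s)\<bar> < e / 2"
      using \<open>0 < e\<close> unfolding continuous_at_eps_delta dist_real_def by (metis half_gt_zero)
    have "P e x y" if xy: "x \<le> s" "s \<le> y" "y - x < d" for x y
    proof -
      have "x \<le> y" using xy by simp
      obtain \<tau> where \<tau>: "\<tau> \<in> {x..y}" "G (u y) - G (u x) = G' (u \<tau>) * (u y - u x)"
        using mean_value_along_curve[of G G' x y u] G is_primitive_continuous[OF uv] \<open>x \<le> y\<close> by blast
      have "((\<lambda>t. G' (u \<tau>) * v t - w t) has_integral (G' (u \<tau>) * (u y - u x) - integral {x..y} w)) {x..y}"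
        by (intro has_integral_diff has_integral_mult_right is_primitive_has_integral[OF uv]
            \<open>x \<le> y\<close> integrable_integral wint)
      then have eq: "((\<lambda>t. G' (u \<tau>) * v t - w t) has_integral (G (u y) - G (u x) - integral {x..y} w)) {x..y}"
        using \<tau> by simp
      have "norm (integral {x..y} (\<lambda>t. G' (u \<tau>) * v t - w t)) \<le> integral {x..y} (\<lambda>t. e * \<bar>v t\<bar>)"
      proof (rule integral_norm_bound_integral)
        fix t assume t: "t \<in> {x..y}"
        have "\<bar>G' (u \<tau>) - G' (u t)\<bar> \<le> e"
        proof -
          have "\<bar>t - s\<bar> < d" "\<bar>\<tau> - s\<bar> < d"
            using t \<tau>(1) xy by auto
          then have "\<bar>G' (u t) - G' (u s)\<bar> < e / 2" "\<bar>G' (u \<tau>) - G' (u s)\<bar> < e / 2"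
            using d by blast+
          then show ?thesis by linarith
        qed
        then show "norm (G' (u \<tau>) * v t - w t) \<le> e * \<bar>v t\<bar>"
          by (simp add: w_def left_diff_distrib[symmetric] abs_mult mult_right_mono)
      qed (use eq in \<open>auto intro!: integrable_on_mult_right vabs\<close>)
      then show ?thesis
        using eq by (simp add: P_def integral_unique)
    qed
    with \<open>0 < d\<close> show "\<exists>d>0. \<forall>x y. x \<le> s \<and> s \<le> y \<and> y - x < d \<longrightarrow> P e x y"
      by blast
  qed
  have "integral {a..b} w = G (u b) - G (u a)" if "a \<le> b" for a b
  proof -
    define K where "K = integral {a..b} (\<lambda>t. \<bar>v t\<bar>)"
    have "K \<ge> 0"
      unfolding K_def by (rule integral_nonneg[OF vabs]) simp
    have "\<bar>G (u b) - G (u a) - integral {a..b} w\<bar> \<le> e" if "0 < e" for e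
    proof -
      \<comment> \<open>Dividing by \<open>K + 1\<close> instead of \<open>K\<close> covers the case
        \<open>K = 0\<close>.\<close>
      have "\<bar>G (u b) - G (u a) - integral {a..b} w\<bar> \<le> e / (K + 1) * K"
        using P[of "e / (K+1)" a b] \<open>0 < e\<close> \<open>K \<ge> 0\<close> \<open>a \<le> b\<close> by (simp add: P_def K_def)
      also have "\<dots> \<le> e"
        using \<open>0 < e\<close> \<open>K \<ge> 0\<close> by (simp add: field_simps)
      finally show ?thesis .
    qed
    then have "\<bar>G (u b) - G (u a) - integral {a..b} w\<bar> \<le> 0"
      by (rule field_le_epsilon) simp
    then show ?thesis by simp
  qed
  with int wint show ?thesis
    by (simp add: is_primitive_def w_def has_integral_iff)
qed

text \<open>Polarisation expresses the product through squares, to which the chain rule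
  applies.\<close>

lemma is_primitive_mult:
  assumes "is_primitive u v" "is_primitive w z"
  shows "is_primitive (\<lambda>t. u t * w t) (\<lambda>t. u t * z t + v t * w t)"
proof -
  have sq: "is_primitive (\<lambda>t. (p t)\<^sup>2) (\<lambda>t. 2 * p t * q t)" if "is_primitive p q" for p q
    by (rule is_primitive_compose_C1[OF that]) (auto intro!: derivative_eq_intros continuous_intros)
  have "is_primitive (\<lambda>t. 1/2 * ((u t + w t)\<^sup>2 - (u t)\<^sup>2 - (w t)\<^sup>2))
    (\<lambda>t. 1/2 * (2 * (u t + w t) * (v t + z t) - 2 * u t * v t - 2 * w t * z t))"
    by (intro is_primitive_cmult is_primitive_diff sq is_primitive_add assms)
  then show ?thesis
    by (simp add: power2_eq_square algebra_simps)
qed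

lemma locally_integrable_has_primitive:
  assumes "locally_integrable v"
  obtains V where "is_primitive V v"
proof -
  \<comment> \<open>One of the two intervals is empty or a point, so this is the signed integral
    from 0 to \<open>x\<close>.\<close>
  define V where "V x = integral {0..x} v - integral {x..0} v" for x
  have v: "v integrable_on {a..b}" for a b
    using assms by (simp add: locally_integrable_def absolutely_integrable_on_def)
  \<comment> \<open>A base point \<open>c\<close> to the left of both 0 and \<open>t\<close> removes
    the sign from the formula; \<open>c = min a 0\<close> then serves both endpoints of
    \<open>{a..b}\<close>.\<close>
  have V: "V t = integral {c..t} v - integral {c..0} v" if "c \<le> t" "c \<le> 0" for c t
  proof (cases "t \<le> 0")
    case True
    then have "integral {c..t} v + integral {t..0} v = integral {c..0} v"
      using v that by (intro Henstock_Kurzweil_Integration.integral_combine) auto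
    moreover have "integral {0..t} v = 0"
      using True by (intro integral_null[of 0 t, unfolded box_real]) auto
    ultimately show ?thesis by (simp add: V_def)
  next
    case False
    then have "integral {c..0} v + integral {0..t} v = integral {c..t} v"
      using v that by (intro Henstock_Kurzweil_Integration.integral_combine) auto
    with False show ?thesis by (simp add: V_def)
  qed
  have "is_primitive V v"
    unfolding is_primitive_def
  proof (intro conjI allI impI)
    show "v absolutely_integrable_on {a..b}" for a b
      using assms by (simp add: locally_integrable_def)
    fix a b :: real assume "a \<le> b"
    have "integral {min a 0..a} v + integral {a..b} v = integral {min a 0..b} v"
      using v \<open>a \<le> b\<close> by (intro Henstock_Kurzweil_Integration.integral_combine) auto
    then have "integral {a..b} v = V b - V a"
      using V[of "min a 0" a] V[of "min a 0" b] \<open>a \<le> b\<close> by simp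
    then show "(v has_integral (V b - V a)) {a..b}"
      using v by (metis integrable_integral)
  qed
  with that show ?thesis by blast
qed

lemma continuous_has_antiderivative:
  fixes H :: "real \<Rightarrow> real"
  assumes H: "continuous_on UNIV H"
  obtains A where "\<And>x. (A has_real_derivative H x) (at x)"
proof -
  have cont: "continuous_on {a..b} H" for a b
    by (rule continuous_on_subset[OF H subset_UNIV])
  have "locally_integrable H"
    unfolding locally_integrable_def by (intro allI absolutely_integrable_continuous_real cont)
  then obtain A where A: "is_primitive A H"
    using locally_integrable_has_primitive by blast
  have "(A has_real_derivative H x) (at x)" for x
  proof -
    have "((\<lambda>t. integral {x-1..t} H) has_real_derivative H x) (at x within {x-1..x+1})"
      by (rule integral_has_real_derivative[OF cont]) simp
    then have "((\<lambda>t. integral {x-1..t} H) has_real_derivative H x) (at x)"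
      by (subst (asm) at_within_interior) auto
    then have "((\<lambda>t. A (x-1) + integral {x-1..t} H) has_real_derivative H x) (at x)"
      by (auto intro!: derivative_eq_intros)
    then show ?thesis
    proof (rule has_field_derivative_transform_within_open[where S="{x-1<..<x+1}"])
      fix t assume "t \<in> {x-1<..<x+1}"
      then show "A (x-1) + integral {x-1..t} H = A t"
        using is_primitive_has_integral[OF A, of "x-1" t] by (simp add: integral_unique)
    qed auto
  qed
  then show ?thesis using that by blast
qed

text \<open>The difference quotients \<open>k (H(x + 1/k) - H(x))\<close> are the continuous derivatives of the
  moving averages of \<open>H\<close>, so the chain rule passes to the limit although \<open>H'\<close> need not be
  continuous.\<close>
lemma is_primitive_compose_differentiable:
  assumes uv: "is_primitive u v"
    and H: "\<And>x. (H has_real_derivative H' x) (at x)"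
    and lip: "\<And>M. \<exists>L. \<forall>x\<in>{-M..M}. \<forall>y\<in>{-M..M}. \<bar>H x - H y\<bar> \<le> L * \<bar>x - y\<bar>"
  shows "is_primitive (\<lambda>t. H (u t)) (\<lambda>t. H' (u t) * v t)"
proof -
  have contH: "continuous_on UNIV H"
    using DERIV_isCont[OF H] by (simp add: continuous_at_imp_continuous_on)
  obtain A where A: "\<And>x. (A has_real_derivative H x) (at x)"
    using continuous_has_antiderivative[OF contH] by blast
  define e where "e k = 1 / real (Suc k)" for k
  have e0: "e k > 0" "e k \<le> 1" for k by (auto simp: e_def field_simps)
  have elim: "e \<longlonglongrightarrow> 0" 
    unfolding e_def by (rule LIMSEQ_Suc[OF lim_1_over_n])
  define Q where "Q k x = (H (x + e k) - H x) / e k" for k x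
  define B where "B k x = (A (x + e k) - A x) / e k" for k x
  have B': "(B k has_real_derivative Q k x) (at x)" for k x
  proof -
    have "((\<lambda>x. A (x + e k)) has_real_derivative H (x + e k)) (at x)"
      using A[of "x + e k"] by (simp add: DERIV_shift)
    then show ?thesis
      unfolding B_def Q_def using A by (intro DERIV_cdivide DERIV_diff)
  qed
  have contQ: "continuous_on UNIV (Q k)" for k
    unfolding Q_def using e0[of k]
    by (intro continuous_intros continuous_on_compose2[OF contH]) auto
  have prim: "is_primitive (\<lambda>t. B k (u t)) (\<lambda>t. Q k (u t) * v t)" for k
    by (rule is_primitive_compose_C1[OF uv B' contQ])
  have eat: "filterlim e (at 0) sequentially"
    unfolding filterlim_at using elim e0 by (simp add: less_imp_neq[symmetric] eventually_sequentially e_def)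
  have Qlim: "(\<lambda>k. Q k x) \<longlonglongrightarrow> H' x" for x
  proof -
    have "((\<lambda>h. (H (x + h) - H x) / h) \<longlongrightarrow> H' x) (at 0)"
      using H[of x] by (simp add: DERIV_def)
    then show ?thesis
      unfolding Q_def using eat by (rule filterlim_compose)
  qed
  have Blim: "(\<lambda>k. B k x) \<longlonglongrightarrow> H x" for x
  proof -
    have "((\<lambda>h. (A (x + h) - A x) / h) \<longlongrightarrow> H x) (at 0)"
      using A[of x] by (simp add: DERIV_def)
    then show ?thesis
      unfolding B_def using eat by (rule filterlim_compose)
  qed
  show ?thesis
    unfolding is_primitive_def
  proof (intro conjI allI impI)
    fix a b :: real
    have "bounded (u ` {a..b})"
      using is_primitive_continuous[OF uv] compact_continuous_image compact_imp_bounded by blast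
    then obtain M where "\<forall>x\<in>u ` {a..b}. norm x \<le> M"
      unfolding bounded_iff by blast
    then have M: "\<bar>u t\<bar> \<le> M" if "t \<in> {a..b}" for t
      using that by auto
    \<comment> \<open>Since \<open>e k \<le> 1\<close>, the shifted points \<open>u t + e k\<close>
      stay within the enlarged bound \<open>M + 1\<close>.\<close>
    obtain L where L: "\<And>x y. x \<in> {-(M+1)..M+1} \<Longrightarrow> y \<in> {-(M+1)..M+1} \<Longrightarrow> \<bar>H x - H y\<bar> \<le> L * \<bar>x - y\<bar>"
      using lip[of "M+1"] by blast
    have Qb: "\<bar>Q k (u t)\<bar> \<le> L" if "t \<in> {a..b}" for k t
    proof -
      have "\<bar>H (u t + e k) - H (u t)\<bar> \<le> L * \<bar>u t + e k - u t\<bar>"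
        using M[OF that] e0[of k] by (intro L) auto
      then show ?thesis
        using e0[of k] by (simp add: Q_def field_simps)
    qed
    have f: "(\<lambda>t. Q k (u t) * v t) absolutely_integrable_on {a..b}" for k
      using prim by (rule is_primitive_absolutely_integrable)
    have h: "(\<lambda>t. L * \<bar>v t\<bar>) integrable_on {a..b}"
      using is_primitive_absolutely_integrable[OF uv, of a b]
      by (intro integrable_on_mult_right) (simp add: absolutely_integrable_on_def)
    have lim: "(\<lambda>k. Q k (u t) * v t) \<longlonglongrightarrow> H' (u t) * v t" for t
      by (intro tendsto_intros Qlim)
    have bd: "norm (Q k (u t) * v t) \<le> L * \<bar>v t\<bar>" if "t \<in> {a..b}" for k t
      using Qb[OF that, of k] by (simp add: abs_mult mult_right_mono)
    have bd': "norm (H' (u t) * v t) \<le> L * \<bar>v t\<bar>" if "t \<in> {a..b}" for t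
      by (rule LIMSEQ_le_const2[OF tendsto_norm[OF lim]]) (use bd[OF that] in auto)
    show "(\<lambda>t. H' (u t) * v t) absolutely_integrable_on {a..b}"
      by (rule dominated_convergence_absolutely_integrable[OF f h bd' lim])
    assume "a \<le> b"
    have "(\<lambda>k. integral {a..b} (\<lambda>t. Q k (u t) * v t)) \<longlonglongrightarrow> integral {a..b} (\<lambda>t. H' (u t) * v t)"
      by (rule dominated_convergence(2)[OF _ h bd lim])
         (use f in \<open>auto simp: absolutely_integrable_on_def\<close>)
    moreover have "integral {a..b} (\<lambda>t. Q k (u t) * v t) = B k (u b) - B k (u a)" for k
      by (rule integral_unique[OF is_primitive_has_integral[OF prim \<open>a \<le> b\<close>]])
    moreover have "(\<lambda>k. B k (u b) - B k (u a)) \<longlonglongrightarrow> H (u b) - H (u a)"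
      by (intro tendsto_intros Blim)
    ultimately have "integral {a..b} (\<lambda>t. H' (u t) * v t) = H (u b) - H (u a)"
      using LIMSEQ_unique by auto
    moreover have "(\<lambda>t. H' (u t) * v t) integrable_on {a..b}"
      using \<open>(\<lambda>t. H' (u t) * v t) absolutely_integrable_on {a..b}\<close> by (simp add: absolutely_integrable_on_def)
    ultimately show "((\<lambda>t. H' (u t) * v t) has_integral (H (u b) - H (u a))) {a..b}"
      by (metis integrable_integral)
  qed
qed

section \<open>Test functions\<close>

lemma test_function_has_derivative:
  assumes "test_function \<phi>"
  shows "(\<phi> has_real_derivative deriv \<phi> x) (at x)" and "continuous_on UNIV (deriv \<phi>)"
proof -
  have d: "((deriv ^^ k) \<phi>) field_differentiable (at x)" for k x
    using assms by (simp add: test_function_def)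
  show "(\<phi> has_real_derivative deriv \<phi> x) (at x)"
    using d[of 0 x] by (simp add: DERIV_deriv_iff_field_differentiable)
  show "continuous_on UNIV (deriv \<phi>)"
    using d[of 1] by (auto simp: continuous_on_eq_continuous_at intro!: field_differentiable_imp_continuous_at)
qed

lemma test_function_support:
  assumes "test_function \<phi>"
  obtains R where "R > 0" and "\<And>x. x \<notin> {-R<..<R} \<Longrightarrow> \<phi> x = 0" and "\<And>x. x \<notin> {-R<..<R} \<Longrightarrow> deriv \<phi> x = 0"
proof -
  have "bounded {x. \<phi> x \<noteq> 0}"
    using assms compact_imp_bounded bounded_subset closure_subset unfolding test_function_def by blast
  then obtain B where "0 < B" and B: "\<And>x. \<phi> x \<noteq> 0 \<Longrightarrow> \<bar>x\<bar> \<le> B"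
    unfolding bounded_pos by auto
  \<comment> \<open>The margin 1 puts \<open>x\<close> inside the open complement of
    \<open>{-B..B}\<close>, where \<open>\<phi>\<close> vanishes identically and hence so does its
    derivative.\<close>
  have "deriv \<phi> x = 0" if x: "x \<notin> {-(B+1)<..<B+1}" for x
  proof -
    have "((\<lambda>x. 0) has_real_derivative 0) (at x)"
      by simp
    then have "(\<phi> has_real_derivative 0) (at x)"
    proof (rule has_field_derivative_transform_within_open[where S="- {-B..B}"])
      show "x \<in> - {-B..B}" using x \<open>0 < B\<close> by auto
      show "0 = \<phi> y" if "y \<in> - {-B..B}" for y
        using B[of y] that by (cases "\<phi> y = 0") auto
    qed (simp add: open_Compl)
    then show ?thesis by (rule DERIV_imp_deriv)
  qed
  moreover have "\<phi> x = 0" if "x \<notin> {-(B+1)<..<B+1}" for x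
    using B[of x] that by force
  ultimately show ?thesis
    using that[of "B+1"] \<open>0 < B\<close> by simp
qed

lemma lebesgue_integral_restrict:
  fixes f :: "real \<Rightarrow> real"
  assumes "f absolutely_integrable_on {a..b}" and "\<And>x. x \<notin> {a..b} \<Longrightarrow> f x = 0"
  shows "integrable lebesgue f" and "(LINT x|lebesgue. f x) = integral {a..b} f"
proof -
  have eq: "(\<lambda>x. indicator {a..b} x *\<^sub>R f x) = f"
  proof
    fix x show "indicator {a..b} x *\<^sub>R f x = f x"
      using assms(2)[of x] by (cases "x \<in> {a..b}") auto
  qed
  show "integrable lebesgue f"
    using assms(1) eq by (simp add: set_integrable_def)
  show "(LINT x|lebesgue. f x) = integral {a..b} f"
    using set_lebesgue_integral_eq_integral(2)[OF assms(1)] eq by (simp add: set_lebesgue_integral_def)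
qed

text \<open>Integration by parts: \<open>u t * \<phi> t\<close> is a primitive by the product rule,
  and its boundary values vanish outside the support of \<open>\<phi>\<close>.\<close>

lemma is_primitive_has_weak_deriv:
  assumes uv: "is_primitive u v"
  shows "has_weak_deriv u v"
  unfolding has_weak_deriv_def
proof (intro conjI allI impI)
  show "locally_integrable u"
    using is_primitive_continuous[OF uv] absolutely_integrable_continuous_real
    by (auto simp: locally_integrable_def)
  show "locally_integrable v"
    using is_primitive_absolutely_integrable[OF uv] by (simp add: locally_integrable_def)
  fix \<phi> assume \<phi>: "test_function \<phi>"
  obtain R where R: "R > 0" "\<And>x. x \<notin> {-R<..<R} \<Longrightarrow> \<phi> x = 0" "\<And>x. x \<notin> {-R<..<R} \<Longrightarrow> deriv \<phi> x = 0"
    using test_function_support[OF \<phi>] by blast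
  note \<phi>' = test_function_has_derivative[OF \<phi>]
  have prim: "is_primitive \<phi> (deriv \<phi>)"
    by (rule C1_is_primitive[OF \<phi>'])
  have i1: "(\<lambda>t. u t * deriv \<phi> t) absolutely_integrable_on {-R..R}"
    by (rule absolutely_integrable_continuous_mult[OF is_primitive_continuous[OF uv]
          is_primitive_absolutely_integrable[OF prim]])
  have i2: "(\<lambda>t. \<phi> t * v t) absolutely_integrable_on {-R..R}"
    by (rule absolutely_integrable_continuous_mult[OF is_primitive_continuous[OF prim]
          is_primitive_absolutely_integrable[OF uv]])
  then have i2: "(\<lambda>t. v t * \<phi> t) absolutely_integrable_on {-R..R}"
    by (simp add: mult.commute)
  have "((\<lambda>t. u t * deriv \<phi> t + v t * \<phi> t) has_integral (u R * \<phi> R - u (-R) * \<phi> (-R))) {-R..R}"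
    using is_primitive_has_integral[OF is_primitive_mult[OF uv prim], of "-R" R] R(1) by simp
  then have "integral {-R..R} (\<lambda>t. u t * deriv \<phi> t + v t * \<phi> t) = 0"
    using R(2) by (simp add: integral_unique)
  then have "integral {-R..R} (\<lambda>t. u t * deriv \<phi> t) + integral {-R..R} (\<lambda>t. v t * \<phi> t) = 0"
    using i1 i2 by (simp add: absolutely_integrable_on_def Henstock_Kurzweil_Integration.integral_add)
  moreover have "(LINT t|lebesgue. u t * deriv \<phi> t) = integral {-R..R} (\<lambda>t. u t * deriv \<phi> t)"
    by (rule lebesgue_integral_restrict(2)[OF i1]) (use R in auto)
  moreover have "(LINT t|lebesgue. v t * \<phi> t) = integral {-R..R} (\<lambda>t. v t * \<phi> t)"
    by (rule lebesgue_integral_restrict(2)[OF i2]) (use R in auto)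
  ultimately show "(LINT t|lebesgue. u t * deriv \<phi> t) = - (LINT t|lebesgue. v t * \<phi> t)"
    by simp
qed

section \<open>Smooth bump functions\<close>

text \<open>For \<open>n = 0\<close> this is the classical smooth function
  \<open>exp (- 1 / y)\<close> extended by 0. The powers of \<open>1 / y\<close> make the derivative
  of each member a linear combination of members.\<close>

definition flat_exp :: "nat \<Rightarrow> real \<Rightarrow> real" where
  "flat_exp n y = (if 0 < y then (1 / y) ^ n * exp (- (1 / y)) else 0)"

lemma flat_exp_tendsto_0: "(flat_exp n \<longlongrightarrow> 0) (at 0)"
proof -
  have "((\<lambda>y. inverse y ^ n / exp (inverse y)) \<longlongrightarrow> 0) (at_right (0::real))"
    by (rule filterlim_compose[OF tendsto_power_div_exp_0 filterlim_inverse_at_top_right])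
  then have "(flat_exp n \<longlongrightarrow> 0) (at_right 0)"
  proof (rule Lim_transform_eventually)
    show "\<forall>\<^sub>F y in at_right 0. inverse y ^ n / exp (inverse y) = flat_exp n y"
      by (rule eventually_mono[OF eventually_at_right_less[of 0]])
         (simp add: flat_exp_def exp_minus divide_inverse)
  qed
  moreover have "(flat_exp n \<longlongrightarrow> 0) (at_left 0)"
  proof (rule Lim_transform_eventually[OF tendsto_const])
    show "\<forall>\<^sub>F y in at_left 0. 0 = flat_exp n y"
      \<comment> \<open>The characterisation of \<open>at_left 0\<close> asks for some point below
        0, which is supplied by choice.\<close>
      unfolding eventually_at_left[OF lt_ex[THEN someI_ex]]
      by (simp add: flat_exp_def) (meson lt_ex)
  qed
  ultimately show ?thesis
    by (simp add: filterlim_split_at)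
qed

lemma flat_exp_has_derivative:
  "(flat_exp n has_real_derivative (- real n * flat_exp (Suc n) y + flat_exp (Suc (Suc n)) y)) (at y)"
proof (cases y "0::real" rule: linorder_cases)
  case less
  have "((\<lambda>x. 0) has_real_derivative 0) (at y)" by simp
  then have "(flat_exp n has_real_derivative 0) (at y)"
    by (rule has_field_derivative_transform_within_open[where S="{..<0}"])
       (use less in \<open>auto simp: flat_exp_def\<close>)
  then show ?thesis using less by (simp add: flat_exp_def)
next
  case equal
  \<comment> \<open>Dividing by \<open>h\<close> merely raises the exponent, so the difference
    quotient at the origin is again a member of the family and tends to 0.\<close>
  have eq: "(flat_exp n (0 + h) - flat_exp n 0) / h = flat_exp (Suc n) h" if "h \<noteq> 0" for h
    using that by (simp add: flat_exp_def)
  have "((\<lambda>h. (flat_exp n (0 + h) - flat_exp n 0) / h) \<longlongrightarrow> 0) (at 0)"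
    by (rule Lim_transform_eventually[OF flat_exp_tendsto_0[of "Suc n"]])
       (auto simp: eventually_at_filter eq simp del: add_0)
  then show ?thesis using equal by (simp add: DERIV_def flat_exp_def)
next
  case greater
  have "((\<lambda>x. (1 / x) ^ n * exp (- (1 / x))) has_real_derivative
     (- real n * flat_exp (Suc n) y + flat_exp (Suc (Suc n)) y)) (at y)"
  proof -
    have "((\<lambda>x. 1 / x) has_real_derivative - ((1 / y)\<^sup>2)) (at y)"
      using greater by (auto intro!: derivative_eq_intros simp: power2_eq_square)
    note d = this
    have "((\<lambda>x. (1 / x) ^ n * exp (- (1 / x))) has_real_derivative
        real n * (1 / y) ^ (n - 1) * - ((1 / y)\<^sup>2) * exp (- (1 / y)) +
        exp (- (1 / y)) * (- (- ((1 / y)\<^sup>2))) * (1 / y) ^ n) (at y)"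
      by (rule DERIV_mult[OF DERIV_power[OF d, THEN DERIV_cong] DERIV_chain2[OF DERIV_exp DERIV_minus[OF d]]])
         simp
    then show ?thesis
      using greater by (cases n) (simp_all add: flat_exp_def power2_eq_square algebra_simps diff_divide_distrib add_divide_distrib)
  qed
  then show ?thesis
    by (rule has_field_derivative_transform_within_open[where S="{0<..}"])
       (use greater in \<open>auto simp: flat_exp_def\<close>)
qed

text \<open>Collects everything that arises from differentiating bumps. Once the set is seen to be
  closed under one differentiation, smoothness follows by iteration without computing higher
  derivatives.\<close>

inductive_set flat_algebra :: "(real \<Rightarrow> real) set" where
  base: "(\<lambda>x. flat_exp n (c * x + t)) \<in> flat_algebra"
| add: "p \<in> flat_algebra \<Longrightarrow> q \<in> flat_algebra \<Longrightarrow> (\<lambda>x. p x + q x) \<in> flat_algebra"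
| mult: "p \<in> flat_algebra \<Longrightarrow> q \<in> flat_algebra \<Longrightarrow> (\<lambda>x. p x * q x) \<in> flat_algebra"
| scale: "p \<in> flat_algebra \<Longrightarrow> (\<lambda>x. k * p x) \<in> flat_algebra"

lemma flat_algebra_derivative:
  "p \<in> flat_algebra \<Longrightarrow> \<exists>p'\<in>flat_algebra. \<forall>x. (p has_real_derivative p' x) (at x)"
proof (induction rule: flat_algebra.induct)
  case (base n c t)
  let ?p' = "\<lambda>x. c * (- real n * flat_exp (Suc n) (c * x + t) + flat_exp (Suc (Suc n)) (c * x + t))"
  have "?p' \<in> flat_algebra"
    by (intro flat_algebra.intros)
  moreover have "((\<lambda>x. flat_exp n (c * x + t)) has_real_derivative ?p' x) (at x)" for x
  proof -
    have "((\<lambda>x. c * x + t) has_real_derivative c) (at x)"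
      by (auto intro!: derivative_eq_intros)
    from DERIV_chain2[OF flat_exp_has_derivative this] show ?thesis
      by (simp add: mult.commute)
  qed
  ultimately show ?case by (intro bexI[of _ ?p']) auto
next
  case (add p q)
  then obtain p' q' where "p' \<in> flat_algebra" "q' \<in> flat_algebra"
    "\<And>x. (p has_real_derivative p' x) (at x)" "\<And>x. (q has_real_derivative q' x) (at x)" by blast
  then show ?case
    by (intro bexI[of _ "\<lambda>x. p' x + q' x"]) (auto intro: flat_algebra.intros DERIV_add)
next
  case (mult p q)
  then obtain p' q' where *: "p' \<in> flat_algebra" "q' \<in> flat_algebra"
    "\<And>x. (p has_real_derivative p' x) (at x)" "\<And>x. (q has_real_derivative q' x) (at x)" by blast
  then have "((\<lambda>x. p x * q x) has_real_derivative p' x * q x + q' x * p x) (at x)" for x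
    by (intro DERIV_mult)
  with * mult show ?case
    by (intro bexI[of _ "\<lambda>x. p' x * q x + q' x * p x"]) (auto intro: flat_algebra.intros)
next
  case (scale p k)
  then obtain p' where *: "p' \<in> flat_algebra" "\<And>x. (p has_real_derivative p' x) (at x)" by blast
  then show ?case
    by (intro bexI[of _ "\<lambda>x. k * p' x"]) (auto intro: flat_algebra.intros DERIV_cmult)
qed

lemma flat_algebra_higher_deriv:
  assumes "p \<in> flat_algebra"
  shows "(deriv ^^ k) p \<in> flat_algebra"
proof (induction k)
  case (Suc k)
  then obtain p' where "p' \<in> flat_algebra" "\<And>x. ((deriv ^^ k) p has_real_derivative p' x) (at x)"
    using flat_algebra_derivative by blast
  moreover from this have "deriv ((deriv ^^ k) p) = p'"
    by (auto intro: DERIV_imp_deriv)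
  ultimately show ?case by simp
qed (use assms in simp)

lemma flat_algebra_field_differentiable:
  "p \<in> flat_algebra \<Longrightarrow> p field_differentiable (at x)"
  using flat_algebra_derivative field_differentiable_def by blast

text \<open>Since \<open>exp (-1/x)\<close> to the power \<open>1/k\<close> is \<open>exp (-1/(kx))\<close>, the dilated bumps
  increase to the indicator function of \<open>(a,b)\<close>.\<close>
definition bump :: "nat \<Rightarrow> real \<Rightarrow> real \<Rightarrow> real \<Rightarrow> real" where
  "bump k a b x = flat_exp 0 (real (Suc k) * (x - a)) * flat_exp 0 (real (Suc k) * (b - x))"

lemma bump_in_flat_algebra: "bump k a b \<in> flat_algebra"
proof -
  let ?K = "real (Suc k)"
  have "(\<lambda>x. flat_exp 0 (?K * x + - (?K * a)) * flat_exp 0 (- ?K * x + ?K * b)) \<in> flat_algebra"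
    by (intro flat_algebra.intros)
  moreover have "(\<lambda>x. flat_exp 0 (?K * x + - (?K * a)) * flat_exp 0 (- ?K * x + ?K * b)) = bump k a b"
    by (rule ext) (simp add: bump_def algebra_simps del: of_nat_Suc)
  ultimately show ?thesis by simp
qed

lemma continuous_on_bump: "continuous_on S (bump k a b)"
  using flat_algebra_field_differentiable[OF bump_in_flat_algebra]
  by (intro continuous_at_imp_continuous_on ballI field_differentiable_imp_continuous_at)

lemma bump_bounds: "0 \<le> bump k a b x" "bump k a b x \<le> 1"
proof -
  have "0 \<le> flat_exp 0 y" "flat_exp 0 y \<le> 1" for y
    by (simp_all add: flat_exp_def)
  then show "0 \<le> bump k a b x" "bump k a b x \<le> 1"
    unfolding bump_def by (simp_all add: mult_le_one)
qed

lemma bump_eq_0: "x \<notin> {a<..<b} \<Longrightarrow> bump k a b x = 0"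
  by (auto simp: bump_def flat_exp_def zero_less_mult_iff)

lemma bump_tendsto: "(\<lambda>k. bump k a b x) \<longlonglongrightarrow> indicator {a<..<b} x"
proof (cases "x \<in> {a<..<b}")
  case True
  have lim: "(\<lambda>k. flat_exp 0 (real (Suc k) * s)) \<longlonglongrightarrow> 1" if "0 < s" for s
  proof -
    have "(\<lambda>k. exp (- (1 / s * (1 / real (Suc k))))) \<longlonglongrightarrow> exp (- (1 / s * 0))"
      by (intro tendsto_intros LIMSEQ_Suc[OF lim_1_over_n])
    then show ?thesis
      using that by (simp add: flat_exp_def mult.commute)
  qed
  have "(\<lambda>k. bump k a b x) \<longlonglongrightarrow> 1 * 1"
    unfolding bump_def by (intro tendsto_mult lim) (use True in auto)
  with True show ?thesis by simp
next
  case False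
  then show ?thesis by (simp add: bump_eq_0)
qed

lemma test_functionI:
  assumes "\<And>k x. (deriv ^^ k) \<phi> field_differentiable (at x)" "\<And>x. x \<notin> {a..b} \<Longrightarrow> \<phi> x = 0"
  shows "test_function \<phi>"
proof -
  have "bounded {x. \<phi> x \<noteq> 0}"
    using assms(2) by (intro bounded_subset[OF bounded_closed_interval[of a b]]) blast
  then show ?thesis
    using assms(1) by (simp add: test_function_def)
qed

lemma test_function_bump: "test_function (bump k a b)"
  by (rule test_functionI[where a=a and b=b])
     (auto intro!: flat_algebra_field_differentiable flat_algebra_higher_deriv bump_in_flat_algebra bump_eq_0)

text \<open>An antiderivative \<open>A\<close> of the bump is constant on each side of
  \<open>[a,b]\<close>, but with two possibly different constants. The difference
  \<open>A x - A (x - d)\<close> cancels both, which makes its support compact.\<close>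

lemma bump_shift_antiderivative:
  obtains \<phi> where "test_function \<phi>" "\<And>x. deriv \<phi> x = bump k a b x - bump k (a + d) (b + d) x"
proof -
  obtain A where A: "\<And>x. (A has_real_derivative bump k a b x) (at x)"
    using continuous_has_antiderivative[OF continuous_on_bump] by blast
  have Aeq: "A y = A x" if "x \<le> y" and zero: "\<And>t. t \<in> {x..y} \<Longrightarrow> bump k a b t = 0" for x y
  proof -
    have "(bump k a b has_integral (A y - A x)) {x..y}"
      by (rule is_primitive_has_integral[OF C1_is_primitive[OF A continuous_on_bump] \<open>x \<le> y\<close>])
    moreover have "(bump k a b has_integral 0) {x..y}"
      using zero by (rule has_integral_is_0)
    ultimately have "A y - A x = 0"
      by (rule has_integral_unique)
    then show ?thesis by simp
  qed
  have Aleft: "A x = A a" if "x \<le> a" for x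
    using Aeq[of x a] that bump_eq_0 by force
  have Aright: "A x = A b" if "b \<le> x" for x
    using Aeq[of b x] that bump_eq_0 by force
  define \<phi> where "\<phi> x = A x - A (x - d)" for x
  have \<phi>': "(\<phi> has_real_derivative (bump k a b x - bump k (a + d) (b + d) x)) (at x)" for x
  proof -
    have "((\<lambda>x. A (x + - d)) has_real_derivative bump k a b (x + - d)) (at x)"
      using A[of "x + - d"] by (simp only: DERIV_shift)
    moreover have "bump k a b (x + - d) = bump k (a + d) (b + d) x"
      by (simp add: bump_def algebra_simps)
    ultimately show ?thesis
      unfolding \<phi>_def using DERIV_diff[OF A] by simp
  qed
  have deriv: "deriv \<phi> = (\<lambda>x. bump k a b x + (-1) * bump k (a + d) (b + d) x)"
    using DERIV_imp_deriv[OF \<phi>'] by auto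
  have "test_function \<phi>"
  proof (rule test_functionI[where a="min a (a+d)" and b="max b (b+d)"])
    fix j x
    show "(deriv ^^ j) \<phi> field_differentiable (at x)"
    proof (cases j)
      case 0
      then show ?thesis using \<phi>' field_differentiable_def by auto
    next
      case (Suc i)
      \<comment> \<open>Only the derivative of \<open>\<phi>\<close> is known to lie in the algebra;
        this settles all orders from one on.\<close>
      have "deriv \<phi> \<in> flat_algebra"
        unfolding deriv by (intro flat_algebra.intros bump_in_flat_algebra)
      then show ?thesis
        by (simp only: Suc funpow_Suc_right o_apply)
           (intro flat_algebra_field_differentiable flat_algebra_higher_deriv)
    qed
  next
    fix x assume "x \<notin> {min a (a+d)..max b (b+d)}"
    then consider "x \<le> a" "x - d \<le> a" | "b \<le> x" "b \<le> x - d" by fastforce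
    then show "\<phi> x = 0"
      by cases (use Aleft[of x] Aleft[of "x - d"] Aright[of x] Aright[of "x - d"] in \<open>simp_all add: \<phi>_def\<close>)
  qed
  with deriv that show ?thesis by simp
qed

section \<open>Weak derivatives and primitives\<close>

lemma locally_integrable_bump_mult:
  assumes "locally_integrable v"
  shows "integrable lebesgue (\<lambda>t. v t * bump k a b t)"
    and "(LINT t|lebesgue. v t * bump k a b t) = integral {a..b} (\<lambda>t. v t * bump k a b t)"
proof -
  have "(\<lambda>t. bump k a b t * v t) absolutely_integrable_on {a..b}"
    using assms by (intro absolutely_integrable_continuous_mult continuous_on_bump) (simp add: locally_integrable_def)
  then have "(\<lambda>t. v t * bump k a b t) absolutely_integrable_on {a..b}"
    by (simp add: mult.commute)
  then show "integrable lebesgue (\<lambda>t. v t * bump k a b t)"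
    "(LINT t|lebesgue. v t * bump k a b t) = integral {a..b} (\<lambda>t. v t * bump k a b t)"
    by (rule lebesgue_integral_restrict; use bump_eq_0 in force)+
qed

text \<open>Dominated convergence, with the endpoints negligible. Through this limit identities
  against test functions become identities between integrals over intervals.\<close>

lemma bump_integral_tendsto:
  assumes v: "locally_integrable v"
  shows "(\<lambda>k. LINT t|lebesgue. v t * bump k a b t) \<longlonglongrightarrow> integral {a..b} v"
proof -
  have vi: "v absolutely_integrable_on {a..b}"
    using v by (simp add: locally_integrable_def)
  have "(\<lambda>k. integral {a..b} (\<lambda>t. v t * bump k a b t)) \<longlonglongrightarrow> integral {a..b} (\<lambda>t. v t * indicator {a<..<b} t)"
  proof (rule dominated_convergence(2)[where h="\<lambda>t. \<bar>v t\<bar>"])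
    show "(\<lambda>t. v t * bump k a b t) integrable_on {a..b}" for k
      using absolutely_integrable_continuous_mult[OF continuous_on_bump vi, of k a b]
      by (simp add: mult.commute absolutely_integrable_on_def)
    show "(\<lambda>t. \<bar>v t\<bar>) integrable_on {a..b}"
      using vi by (simp add: absolutely_integrable_on_def)
    show "norm (v t * bump k a b t) \<le> \<bar>v t\<bar>" for k t
      using bump_bounds[of k a b t] by (simp add: abs_mult mult_left_le)
    show "(\<lambda>k. v t * bump k a b t) \<longlonglongrightarrow> v t * indicator {a<..<b} t" for t
      by (intro tendsto_intros bump_tendsto)
  qed
  moreover have "integral {a..b} (\<lambda>t. v t * indicator {a<..<b} t) = integral {a..b} v"
    by (rule integral_spike[of "{a,b}"]) (auto simp: indicator_def)
  ultimately show ?thesis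
    by (simp add: locally_integrable_bump_mult(2)[OF v])
qed

section \<open>Recovering functions from their integrals over intervals\<close>

text \<open>The Lebesgue differentiation theorem in one-sided form, with a single exceptional set
  for the function.\<close>

lemma locally_integrable_right_density:
  assumes "locally_integrable f"
  obtains N where "negligible N"
    and "\<And>x. x \<notin> N \<Longrightarrow> ((\<lambda>h. integral {x..x+h} f / h) \<longlongrightarrow> f x) (at_right 0)"
proof -
  have "f integrable_on cbox a b" for a b
    using assms by (simp add: locally_integrable_def absolutely_integrable_on_def)
  from integrable_ccontinuous_explicit[OF this] obtain N where "negligible N"
    and N: "\<And>x e. \<lbrakk>x \<notin> N; 0 < e\<rbrakk> \<Longrightarrow> \<exists>d>0. \<forall>h. 0 < h \<and> h < d \<longrightarrow> norm (integral {x..x+h} f / h - f x) < e"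
    by (auto simp: divide_inverse_commute)
  have "((\<lambda>h. integral {x..x+h} f / h) \<longlongrightarrow> f x) (at_right 0)" if "x \<notin> N" for x
    unfolding tendsto_iff dist_norm
  proof (intro allI impI)
    fix e :: real assume "0 < e"
    from N[OF that this] show "\<forall>\<^sub>F h in at_right 0. norm (integral {x..x+h} f / h - f x) < e"
      unfolding eventually_at_right_field by auto
  qed
  with \<open>negligible N\<close> that show ?thesis by blast
qed

lemma AE_lebesgueI_negligible:
  assumes "negligible N" "\<And>x. x \<notin> N \<Longrightarrow> P x"
  shows "AE x in lebesgue. P x"
  unfolding eventually_ae_filter_negligible using assms by blast

lemma AE_eq_if_integrals_eq:
  assumes f: "locally_integrable f" and g: "locally_integrable g"
    and eq: "\<And>a b. integral {a..b} f = integral {a..b} g"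
  shows "AE x in lebesgue. f x = g x"
proof -
  obtain N where N: "negligible N" "\<And>x. x \<notin> N \<Longrightarrow> ((\<lambda>h. integral {x..x+h} f / h) \<longlongrightarrow> f x) (at_right 0)"
    using locally_integrable_right_density[OF f] by blast
  obtain M where M: "negligible M" "\<And>x. x \<notin> M \<Longrightarrow> ((\<lambda>h. integral {x..x+h} g / h) \<longlongrightarrow> g x) (at_right 0)"
    using locally_integrable_right_density[OF g] by blast
  show ?thesis
  proof (rule AE_lebesgueI_negligible[of "N \<union> M"])
    show "negligible (N \<union> M)" using N(1) M(1) by (rule negligible_Un)
    fix x assume "x \<notin> N \<union> M"
    then show "f x = g x"
      using tendsto_unique[OF _ N(2)[of x, unfolded eq] M(2)[of x]] by simp
  qed
qed

text \<open>The fundamental lemma of the calculus of variations: pairings with bumps determine the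
  integrals over intervals, and these determine the function almost everywhere.\<close>

lemma has_weak_deriv_unique:
  assumes "has_weak_deriv u v" "has_weak_deriv u w"
  shows "AE t in lebesgue. v t = w t"
proof (rule AE_eq_if_integrals_eq)
  show v: "locally_integrable v" and w: "locally_integrable w"
    using assms by (simp_all add: has_weak_deriv_def)
  fix a b
  have "(LINT t|lebesgue. v t * bump k a b t) = (LINT t|lebesgue. w t * bump k a b t)" for k
    using assms test_function_bump[of k a b] unfolding has_weak_deriv_def by fastforce
  then show "integral {a..b} v = integral {a..b} w"
    using LIMSEQ_unique[OF bump_integral_tendsto[OF v, of a b]] bump_integral_tendsto[OF w, of a b] by simp
qed

text \<open>Testing against primitives of \<open>bump k a b - bump k (a + d) (b + d)\<close> shows that \<open>u\<close> and a
  primitive \<open>V\<close> of \<open>v\<close> have integrals over \<open>[a,b]\<close> whose difference is translation invariant; hence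
  all densities of \<open>u - V\<close> agree.\<close>
lemma has_weak_deriv_imp_primitive:
  assumes uv: "has_weak_deriv u v"
  obtains U where "is_primitive U v" "AE t in lebesgue. u t = U t"
proof -
  have u: "locally_integrable u" and v: "locally_integrable v"
    using uv by (simp_all add: has_weak_deriv_def)
  obtain V where V: "is_primitive V v"
    using locally_integrable_has_primitive[OF v] by blast
  have Vv: "has_weak_deriv V v"
    by (rule is_primitive_has_weak_deriv[OF V])
  then have Vl: "locally_integrable V"
    by (simp add: has_weak_deriv_def)
  have shift: "integral {a..b} u - integral {a+d..b+d} u = integral {a..b} V - integral {a+d..b+d} V" for a b d
  proof -
    have "(LINT t|lebesgue. u t * bump k a b t) - (LINT t|lebesgue. u t * bump k (a+d) (b+d) t)
        = (LINT t|lebesgue. V t * bump k a b t) - (LINT t|lebesgue. V t * bump k (a+d) (b+d) t)" for k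
    proof -
      obtain \<phi> where \<phi>: "test_function \<phi>" "\<And>x. deriv \<phi> x = bump k a b x - bump k (a + d) (b + d) x"
        using bump_shift_antiderivative by blast
      have "(LINT t|lebesgue. u t * deriv \<phi> t) = (LINT t|lebesgue. V t * deriv \<phi> t)"
        using uv Vv \<phi>(1) by (simp add: has_weak_deriv_def)
      then show ?thesis
        by (simp add: \<phi>(2) right_diff_distrib Bochner_Integration.integral_diff
            locally_integrable_bump_mult(1)[OF u] locally_integrable_bump_mult(1)[OF Vl])
    qed
    then have eq: "(\<lambda>k. (LINT t|lebesgue. u t * bump k a b t) - (LINT t|lebesgue. u t * bump k (a+d) (b+d) t))
        = (\<lambda>k. (LINT t|lebesgue. V t * bump k a b t) - (LINT t|lebesgue. V t * bump k (a+d) (b+d) t))"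
      by simp
    have lim: "(\<lambda>k. (LINT t|lebesgue. w t * bump k a b t) - (LINT t|lebesgue. w t * bump k (a+d) (b+d) t))
      \<longlonglongrightarrow> integral {a..b} w - integral {a+d..b+d} w" if "locally_integrable w" for w
      by (intro tendsto_diff bump_integral_tendsto that)
    show ?thesis
      by (rule LIMSEQ_unique[OF lim[OF u, unfolded eq] lim[OF Vl]])
  qed
  obtain N where N: "negligible N" "\<And>x. x \<notin> N \<Longrightarrow> ((\<lambda>h. integral {x..x+h} u / h) \<longlongrightarrow> u x) (at_right 0)"
    using locally_integrable_right_density[OF u] by blast
  obtain M where M: "negligible M" "\<And>x. x \<notin> M \<Longrightarrow> ((\<lambda>h. integral {x..x+h} V / h) \<longlongrightarrow> V x) (at_right 0)"
    using locally_integrable_right_density[OF Vl] by blast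
  have NM: "negligible (N \<union> M)" using N(1) M(1) by (rule negligible_Un)
  then obtain x0 where x0: "x0 \<notin> N \<union> M"
    by (metis UNIV_eq_I non_negligible_UNIV)
  have "u x = V x + (u x0 - V x0)" if x: "x \<notin> N \<union> M" for x
  proof -
    have "((\<lambda>h. integral {x0..x0+h} u / h - integral {x..x+h} u / h) \<longlongrightarrow> u x0 - u x) (at_right 0)"
      using x x0 N(2) by (intro tendsto_diff) auto
    moreover have "((\<lambda>h. integral {x0..x0+h} V / h - integral {x..x+h} V / h) \<longlongrightarrow> V x0 - V x) (at_right 0)"
      using x x0 M(2) by (intro tendsto_diff) auto
    \<comment> \<open>Translation by \<open>x - x0\<close> carries \<open>{x0..x0+h}\<close> to
      \<open>{x..x+h}\<close>, so the invariance compares the densities at the two points.\<close>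
    moreover have "integral {x0..x0+h} u / h - integral {x..x+h} u / h
        = integral {x0..x0+h} V / h - integral {x..x+h} V / h" for h
      using shift[of x0 "x0+h" "x - x0"] by (simp add: add.commute flip: diff_divide_distrib)
    ultimately have "u x0 - u x = V x0 - V x"
      using tendsto_unique[of "at_right (0::real)"] by simp
    then show ?thesis by simp
  qed
  then have "AE t in lebesgue. u t = V t + (u x0 - V x0)"
    using NM by (rule AE_lebesgueI_negligible[rotated])
  moreover have "is_primitive (\<lambda>t. V t + (u x0 - V x0)) v"
    using V by (simp add: is_primitive_def)
  ultimately show ?thesis using that by blast
qed

section \<open>Periodic functions\<close>

definition periodic :: "real \<Rightarrow> (real \<Rightarrow> 'a) \<Rightarrow> bool" where
  "periodic T u \<longleftrightarrow> (\<forall>t. u (t + T) = u t)"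

lemma periodicD: "periodic T u \<Longrightarrow> u (t + T) = u t"
  by (simp add: periodic_def)

lemma periodic_of_nat: "periodic T u \<Longrightarrow> u (t + real k * T) = u t"
proof (induction k)
  case (Suc k)
  have "u (t + real (Suc k) * T) = u (t + real k * T + T)"
    by (simp add: algebra_simps)
  with Suc show ?case by (simp add: periodicD)
qed simp

lemma periodic_of_int:
  assumes "periodic T u"
  shows "u (t + of_int k * T) = u t"
proof (cases "k \<ge> 0")
  case True
  then show ?thesis using periodic_of_nat[OF assms, of t "nat k"] by simp
next
  case False
  then show ?thesis
    using periodic_of_nat[OF assms, of "t + of_int k * T" "nat (- k)"] by (simp add: algebra_simps)
qed

lemma periodic_representative:
  assumes u: "periodic T u" and "T > 0"
  obtains r where "r \<in> {0..T}" "u r = u t"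
proof -
  define r where "r = t + of_int (- \<lfloor>t / T\<rfloor>) * T"
  have "of_int \<lfloor>t / T\<rfloor> * T \<le> t" "t \<le> (of_int \<lfloor>t / T\<rfloor> + 1) * T"
    using \<open>T > 0\<close> floor_divide_lower[of T t] floor_divide_upper[of T t] by auto
  then have "r \<in> {0..T}"
    by (simp add: r_def algebra_simps)
  moreover have "u r = u t"
    unfolding r_def by (rule periodic_of_int[OF u])
  ultimately show ?thesis using that by blast
qed

lemma periodic_attains_sup:
  fixes u :: "real \<Rightarrow> real"
  assumes u: "periodic T u" and "T > 0" and cont: "continuous_on UNIV u"
  obtains x where "\<And>t. u t \<le> u x"
proof -
  have "continuous_on {0..T} u"
    by (rule continuous_on_subset[OF cont subset_UNIV])
  then obtain x where x: "x \<in> {0..T}" "\<And>r. r \<in> {0..T} \<Longrightarrow> u r \<le> u x"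
    using continuous_attains_sup[of "{0..T}" u] \<open>T > 0\<close> by auto
  have "u t \<le> u x" for t
    using periodic_representative[OF u \<open>T > 0\<close>, of t] x(2) by metis
  then show ?thesis using that by blast
qed

lemma periodic_bounded:
  fixes u :: "real \<Rightarrow> real"
  assumes u: "periodic T u" and "T > 0" and cont: "continuous_on UNIV u"
  obtains B where "\<And>t. \<bar>u t\<bar> \<le> B"
proof -
  have "periodic T (\<lambda>t. \<bar>u t\<bar>)" "continuous_on UNIV (\<lambda>t. \<bar>u t\<bar>)"
    using u cont by (auto simp: periodic_def intro: continuous_intros)
  then show ?thesis
    using periodic_attains_sup[OF _ \<open>T > 0\<close>] that by blast
qed

lemma has_integral_translate:
  fixes f :: "real \<Rightarrow> real"
  assumes "(f has_integral I) {a..b}"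
  shows "((\<lambda>x. f (x + d)) has_integral I) {a - d..b - d}"
  using has_integral_affinity'[of f I a b 1 d] assms by simp

lemma absolutely_integrable_translate:
  fixes f :: "real \<Rightarrow> real"
  assumes "f absolutely_integrable_on {a..b}"
  shows "(\<lambda>x. f (x + d)) absolutely_integrable_on {a - d..b - d}"
proof -
  have "(\<lambda>x. g (x + d)) integrable_on {a - d..b - d}" if "g integrable_on {a..b}" for g :: "real \<Rightarrow> real"
    using that has_integral_translate unfolding integrable_on_def by blast
  from this[of f] this[of "\<lambda>x. \<bar>f x\<bar>"] assms show ?thesis
    by (simp add: absolutely_integrable_on_def)
qed

lemma periodic_locally_integrable:
  fixes p :: "real \<Rightarrow> real"
  assumes p: "periodic T p" and "T > 0" and int: "p absolutely_integrable_on {0..T}"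
  shows "locally_integrable p"
  unfolding locally_integrable_def
proof (intro allI)
  fix a b :: real
  have *: "p absolutely_integrable_on {0..real k * T}" for k
  proof (induction k)
    case (Suc k)
    have "(\<lambda>x. p (x + - (real k * T))) absolutely_integrable_on {0 - - (real k * T)..T - - (real k * T)}"
      by (rule absolutely_integrable_translate[OF int])
    moreover have "p (x + - (real k * T)) = p x" for x
      using periodic_of_nat[OF p, of "x + - (real k * T)" k] by simp
    ultimately have "p absolutely_integrable_on {real k * T..real (Suc k) * T}"
      by (simp add: algebra_simps)
    from absolutely_integrable_on_combine[OF Suc this] show ?case
      using \<open>T > 0\<close> by (simp add: mult_right_mono)
  next
    case 0
    show ?case
      using absolutely_integrable_negligible[of "{0}" p] by simp
  qed
  obtain k where k: "(\<bar>a\<bar> + \<bar>b\<bar>) / T \<le> real k"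
    using real_arch_simple by blast
  then have k: "\<bar>a\<bar> + \<bar>b\<bar> \<le> real k * T"
    using \<open>T > 0\<close> by (simp add: field_simps)
  \<comment> \<open>A stretch of \<open>2 k\<close> periods moved back by \<open>k\<close> periods
    covers the symmetric interval from \<open>- k T\<close> to \<open>k T\<close>, which contains
    \<open>{a..b}\<close>.\<close>
  have "(\<lambda>x. p (x + real k * T)) absolutely_integrable_on {0 - real k * T..real (2 * k) * T - real k * T}"
    by (rule absolutely_integrable_translate[OF *])
  then have "p absolutely_integrable_on {0 - real k * T..real (2 * k) * T - real k * T}"
    by (simp add: periodic_of_nat[OF p])
  then show "p absolutely_integrable_on {a..b}"
  proof (rule absolutely_integrable_on_subinterval)
    have "0 - real k * T \<le> a" "b \<le> real (2 * k) * T - real k * T"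
      using k by (simp_all add: left_diff_distrib[symmetric])
    then show "{a..b} \<subseteq> {0 - real k * T..real (2 * k) * T - real k * T}"
      by (simp only: atLeastatMost_subset_iff) blast
  qed
qed

text \<open>The increment of \<open>P\<close> over one period does not depend on the starting point
  because \<open>p\<close> is periodic, and at 0 it is the vanishing integral.\<close>

lemma is_primitive_periodic:
  assumes P: "is_primitive P p" and p: "periodic T p"
    and zero: "integral {0..T} p = 0" and "T > 0"
  shows "periodic T P"
proof -
  have eq: "P (b + T) - P (a + T) = P b - P a" if "a \<le> b" for a b
  proof (rule has_integral_unique)
    show "(p has_integral (P b - P a)) {a..b}"
      by (rule is_primitive_has_integral[OF P that])
    show "(p has_integral (P (b + T) - P (a + T))) {a..b}"
      using has_integral_translate[OF is_primitive_has_integral[OF P], of "a+T" "b+T" T] that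
      by (simp add: periodicD[OF p])
  qed
  have "P T = P 0"
    using is_primitive_has_integral[OF P, of 0 T] zero \<open>T > 0\<close> by (simp add: integral_unique)
  then have "P (t + T) = P t" for t
    using eq[of 0 t] eq[of t 0] by (cases "0 \<le> t") auto
  then show ?thesis by (simp add: periodic_def)
qed

lemma AE_lebesgue_translate:
  assumes "AE t in lebesgue. P (t :: real)"
  shows "AE t in lebesgue. P (t + d)"
proof -
  obtain N where N: "negligible N" "{t. \<not> P t} \<subseteq> N"
    using assms unfolding eventually_ae_filter_negligible by blast
  have "negligible ((+) (- d) ` N)"
    by (rule negligible_translation[OF N(1)])
  moreover have "t \<in> (+) (- d) ` N" if "\<not> P (t + d)" for t
    using that N(2) by (intro image_eqI[of _ _ "t + d"]) auto
  ultimately show ?thesis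
    by (intro AE_lebesgueI_negligible[of "(+) (- d) ` N"]) blast+
qed

lemma AE_eq_continuous_imp_eq:
  fixes f g :: "real \<Rightarrow> real"
  assumes "continuous_on UNIV f" "continuous_on UNIV g" and ae: "AE t in lebesgue. f t = g t"
  shows "f t = g t"
proof -
  have "open {t. f t \<noteq> g t}"
    using assms(1,2) by (rule open_Collect_neq)
  moreover have "negligible {t. f t \<noteq> g t}"
    using ae unfolding eventually_ae_filter_negligible by (meson negligible_subset)
  ultimately have "{t. f t \<noteq> g t} = {}"
    using open_not_negligible by blast
  then show ?thesis by blast
qed

lemma continuous_borel_measurable_lebesgue:
  fixes u :: "real \<Rightarrow> real"
  assumes "continuous_on UNIV u"
  shows "u \<in> borel_measurable lebesgue"
  using borel_measurable_continuous_onI[OF assms] by (intro measurable_completion) simp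

section \<open>Periodic square-integrable and Sobolev functions\<close>

lemma L2_per_periodic: "u \<in> L2_per T \<Longrightarrow> periodic T u"
  and L2_per_measurable: "u \<in> L2_per T \<Longrightarrow> u \<in> borel_measurable lebesgue"
  and L2_per_square_integrable: "u \<in> L2_per T \<Longrightarrow> (\<lambda>t. (u t)\<^sup>2) integrable_on {0..T}"
  by (auto simp: L2_per_def periodic_def absolutely_integrable_on_def)

lemma absolutely_integrable_by_bound:
  fixes f h :: "real \<Rightarrow> real"
  assumes "f \<in> borel_measurable lebesgue" "h integrable_on {a..b}" "\<And>t. \<bar>f t\<bar> \<le> h t"
  shows "f absolutely_integrable_on {a..b}"
  by (rule measurable_bounded_by_integrable_imp_absolutely_integrable[OF _ _ assms(2)])
     (use assms in \<open>auto intro: measurable_restrict_space1\<close>)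

lemma L2_perI:
  assumes "periodic T u" "u \<in> borel_measurable lebesgue" "h integrable_on {0..T}"
    "\<And>t. (u t)\<^sup>2 \<le> h t"
  shows "u \<in> L2_per T"
proof -
  have "(\<lambda>t. (u t)\<^sup>2) absolutely_integrable_on {0..T}"
    by (rule absolutely_integrable_by_bound[OF _ assms(3)]) (use assms in auto)
  with assms show ?thesis by (simp add: L2_per_def periodic_def)
qed

lemma continuous_periodic_in_L2_per:
  assumes "periodic T u" "continuous_on UNIV u"
  shows "u \<in> L2_per T"
proof (rule L2_perI[OF assms(1)])
  show "(\<lambda>t. (u t)\<^sup>2) integrable_on {0..T}"
    by (intro integrable_continuous_real continuous_intros continuous_on_subset[OF assms(2) subset_UNIV])
qed (use assms in \<open>auto intro: continuous_borel_measurable_lebesgue\<close>)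

lemma L2_per_bounded_mult:
  assumes v: "v \<in> L2_per T" and "periodic T q" "q \<in> borel_measurable lebesgue" "\<And>t. \<bar>q t\<bar> \<le> B"
  shows "(\<lambda>t. q t * v t) \<in> L2_per T"
proof (rule L2_perI)
  show "(\<lambda>t. B\<^sup>2 * (v t)\<^sup>2) integrable_on {0..T}"
    by (intro integrable_on_mult_right L2_per_square_integrable[OF v])
  show "(q t * v t)\<^sup>2 \<le> B\<^sup>2 * (v t)\<^sup>2" for t
    using power_mono[OF assms(4)[of t], of 2] by (simp add: power_mult_distrib mult_right_mono)
qed (use assms L2_per_periodic[OF v] L2_per_measurable[OF v] in \<open>auto simp: periodic_def\<close>)

lemma L2_per_diff:
  assumes u: "u \<in> L2_per T" and v: "v \<in> L2_per T"
  shows "(\<lambda>t. u t - v t) \<in> L2_per T"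
proof (rule L2_perI)
  show "(\<lambda>t. 2 * (u t)\<^sup>2 + 2 * (v t)\<^sup>2) integrable_on {0..T}"
    by (intro Henstock_Kurzweil_Integration.integrable_add integrable_on_mult_right L2_per_square_integrable u v)
  show "(u t - v t)\<^sup>2 \<le> 2 * (u t)\<^sup>2 + 2 * (v t)\<^sup>2" for t
    using zero_le_power2[of "u t + v t"] by (simp add: power2_eq_square algebra_simps)
qed (use L2_per_periodic[OF u] L2_per_periodic[OF v] L2_per_measurable[OF u] L2_per_measurable[OF v]
    in \<open>auto simp: periodic_def\<close>)

lemma L2_per_locally_integrable:
  assumes u: "u \<in> L2_per T" and "T > 0"
  shows "locally_integrable u"
proof (rule periodic_locally_integrable[OF L2_per_periodic[OF u] \<open>T > 0\<close>])
  have "\<bar>u t\<bar> \<le> 1 + (u t)\<^sup>2" for t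
  proof -
    have "2 * \<bar>u t\<bar> \<le> 1 + \<bar>u t\<bar>\<^sup>2"
      using zero_le_power2[of "\<bar>u t\<bar> - 1"] by (simp add: power2_diff)
    then show ?thesis by simp
  qed
  then show "u absolutely_integrable_on {0..T}"
    by (intro absolutely_integrable_by_bound[OF L2_per_measurable[OF u], where h="\<lambda>t. 1 + (u t)\<^sup>2"]
        Henstock_Kurzweil_Integration.integrable_add L2_per_square_integrable[OF u] integrable_const_ivl)
qed

lemma is_primitive_in_H1_per:
  assumes "is_primitive y v" "periodic T y" "v \<in> L2_per T"
  shows "y \<in> H1_per T"
  unfolding H1_per_def
  using continuous_periodic_in_L2_per[OF assms(2) is_primitive_continuous[OF assms(1)]]
    is_primitive_has_weak_deriv[OF assms(1)] assms(3) by blast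

text \<open>The primitive \<open>U\<close> agrees with \<open>z\<close> only almost everywhere, so
  it inherits periodicity only almost everywhere; continuity of \<open>U\<close> upgrades this to
  every point.\<close>

lemma H1_per_representative:
  assumes "z \<in> H1_per T"
  obtains U v where "v \<in> L2_per T" "has_weak_deriv z v" "is_primitive U v"
    "AE t in lebesgue. z t = U t" "periodic T U"
proof -
  obtain v where v: "v \<in> L2_per T" "has_weak_deriv z v" and z: "z \<in> L2_per T"
    using assms by (auto simp: H1_per_def)
  obtain U where U: "is_primitive U v" "AE t in lebesgue. z t = U t"
    using has_weak_deriv_imp_primitive[OF v(2)] by blast
  have "AE t in lebesgue. U (t + T) = U t"
    using U(2) AE_lebesgue_translate[OF U(2), of T]
    by eventually_elim (simp add: periodicD[OF L2_per_periodic[OF z]])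
  then have "U (t + T) = U t" for t
    by (intro AE_eq_continuous_imp_eq[of "\<lambda>t. U (t + T)" U] is_primitive_continuous[OF U(1)]
        continuous_on_compose2[OF is_primitive_continuous[OF U(1), of UNIV]] continuous_intros) auto
  with v U that show ?thesis by (simp add: periodic_def)
qed

lemma weak_deriv_AE:
  assumes "has_weak_deriv u v"
  shows "AE t in lebesgue. weak_deriv u t = v t"
proof (rule has_weak_deriv_unique)
  show "has_weak_deriv u (weak_deriv u)"
    unfolding weak_deriv_def using assms by (rule someI[of "has_weak_deriv u"])
qed (rule assms)

text \<open>Frees the equation from the choice made in \<open>weak_deriv\<close>, as two weak
  derivatives of \<open>z\<close> differ only on a null set.\<close>

lemma solves_ode_iff:
  assumes "has_weak_deriv z v"
  shows "solves_ode c f g s z \<longleftrightarrow> (AE t in lebesgue. (1 + c) * v t + f (z t) + g (z t) = s t)"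
proof
  assume "solves_ode c f g s z"
  then show "AE t in lebesgue. (1 + c) * v t + f (z t) + g (z t) = s t"
    using weak_deriv_AE[OF assms] unfolding solves_ode_def by eventually_elim simp
next
  assume "AE t in lebesgue. (1 + c) * v t + f (z t) + g (z t) = s t"
  then show "solves_ode c f g s z"
    using weak_deriv_AE[OF assms] unfolding solves_ode_def by eventually_elim simp
qed

text \<open>The delay is exactly \<open>n\<close> periods. While \<open>z\<close> is periodic at
  every point, the chosen \<open>weak_deriv z\<close> may fail to be so; it is compared with a
  periodic weak derivative, which yields the shift identity almost everywhere.\<close>

lemma solves_delay_iff_solves_ode:
  assumes z: "z \<in> H1_per T" and nT: "real n * T = 1"
  shows "solves_delay c f g s z \<longleftrightarrow> solves_ode c f g s z"
proof -
  obtain v where v: "v \<in> L2_per T" "has_weak_deriv z v" and "z \<in> L2_per T"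
    using z by (auto simp: H1_per_def)
  have shift: "u (t - 1) = u t" if "u \<in> L2_per T" for u t
    using periodic_of_nat[OF L2_per_periodic[OF that], of "t - 1" n] nT by simp
  have "AE t in lebesgue. weak_deriv z (t - 1) = v t"
    using AE_lebesgue_translate[OF weak_deriv_AE[OF v(2)], of "-1"] by (simp add: shift[OF v(1)])
  with weak_deriv_AE[OF v(2)] have eq: "AE t in lebesgue. weak_deriv z (t - 1) = weak_deriv z t"
    by eventually_elim simp
  show ?thesis
    unfolding solves_delay_def solves_ode_def
  proof
    assume "AE t in lebesgue. weak_deriv z t + c * weak_deriv z (t - 1) + f (z t) + g (z (t - 1)) = s t"
    then show "AE t in lebesgue. (1 + c) * weak_deriv z t + f (z t) + g (z t) = s t"
      using eq by eventually_elim (simp add: shift[OF \<open>z \<in> L2_per T\<close>] algebra_simps)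
  next
    assume "AE t in lebesgue. (1 + c) * weak_deriv z t + f (z t) + g (z t) = s t"
    then show "AE t in lebesgue. weak_deriv z t + c * weak_deriv z (t - 1) + f (z t) + g (z (t - 1)) = s t"
      using eq by eventually_elim (simp add: shift[OF \<open>z \<in> L2_per T\<close>] algebra_simps)
  qed
qed

section \<open>The nonlinearity\<close>

text \<open>The slope is controlled by bounds on bounded intervals rather than by continuity,
  because \<open>g\<close> is merely differentiable. The lower bound serves the inverse of
  \<open>h\<close>, the upper one the contraction.\<close>

locale coercive_increasing =
  fixes h h' :: "real \<Rightarrow> real"
  assumes deriv: "(h has_real_derivative h' x) (at x)"
    and deriv_bounds: "\<exists>l>0. \<exists>L. \<forall>x\<in>{-M..M}. l \<le> h' x \<and> h' x \<le> L"
    and at_top: "filterlim h at_top at_top"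
    and at_bot: "filterlim h at_bot at_bot"
begin

lemma slopes:
  obtains l L where "0 < l" "l \<le> L"
    "\<And>x y. -M \<le> x \<Longrightarrow> x \<le> y \<Longrightarrow> y \<le> M \<Longrightarrow> l * (y - x) \<le> h y - h x \<and> h y - h x \<le> L * (y - x)"
proof -
  obtain l L where l: "0 < l" "\<And>x. x \<in> {-M..M} \<Longrightarrow> l \<le> h' x \<and> h' x \<le> L"
    using deriv_bounds[of M] by blast
  \<comment> \<open>For negative \<open>M\<close> the bounds are vacuous and \<open>L\<close> may be
    smaller than \<open>l\<close>; the maximum restores the order.\<close>
  have "l * (y - x) \<le> h y - h x \<and> h y - h x \<le> max l L * (y - x)"
    if xy: "-M \<le> x" "x \<le> y" "y \<le> M" for x y
  proof (cases "x = y")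
    case False
    then have "x < y" using xy by simp
    then obtain z where z: "x < z" "z < y" "h y - h x = (y - x) * h' z"
      using MVT2[of x y h h'] deriv by blast
    have "l \<le> h' z" "h' z \<le> max l L"
      using l(2)[of z] z xy by auto
    then have "(y - x) * l \<le> (y - x) * h' z" "(y - x) * h' z \<le> (y - x) * max l L"
      using \<open>x < y\<close> by (simp_all only: mult_left_mono diff_ge_0_iff_ge less_imp_le)
    then show ?thesis
      unfolding z(3) by (metis mult.commute)
  qed simp
  with l(1) that[of l "max l L"] show ?thesis by simp
qed

lemma strict_mono: "x < y \<Longrightarrow> h x < h y"
proof -
  assume "x < y"
  obtain l L where "0 < l" and l: "\<And>a b. -max \<bar>x\<bar> \<bar>y\<bar> \<le> a \<Longrightarrow> a \<le> b \<Longrightarrow> b \<le> max \<bar>x\<bar> \<bar>y\<bar> \<Longrightarrow>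
      l * (b - a) \<le> h b - h a \<and> h b - h a \<le> L * (b - a)"
    by (rule slopes[of "max \<bar>x\<bar> \<bar>y\<bar>"]) blast
  have "l * (y - x) \<le> h y - h x"
    using l[of x y] \<open>x < y\<close> by linarith
  moreover have "0 < l * (y - x)"
    using \<open>0 < l\<close> \<open>x < y\<close> by simp
  ultimately show ?thesis by linarith
qed

lemma less_iff: "h x < h y \<longleftrightarrow> x < y"
  using strict_mono by (metis less_asym linorder_neqE)

lemma eq_iff: "h x = h y \<longleftrightarrow> x = y"
  using strict_mono by (metis less_irrefl linorder_neqE)

lemma continuous: "continuous_on S h"
  by (intro continuous_at_imp_continuous_on ballI DERIV_isCont[OF deriv])

lemma surjective: obtains x where "h x = y"
proof -
  obtain a where a: "h a \<le> y"
    using at_bot unfolding filterlim_at_bot eventually_at_bot_linorder by blast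
  obtain b where b: "y \<le> h b"
    using at_top unfolding filterlim_at_top eventually_at_top_linorder by blast
  have "a \<le> b"
    using a b less_iff[of b a] by linarith
  then show ?thesis
    using IVT'[of h a y b] a b continuous that by blast
qed

definition H :: "real \<Rightarrow> real" where "H = inv h"

lemma h_H [simp]: "h (H y) = y"
  unfolding H_def by (metis surjective f_inv_into_f rangeI)

lemma H_mono: "x \<le> y \<Longrightarrow> H x \<le> H y"
  using less_iff[of "H y" "H x"] by simp

lemma H_bounded_range:
  obtains K where "\<And>x. x \<in> {-M..M} \<Longrightarrow> H x \<in> {-K..K}"
proof
  fix x assume "x \<in> {-M..M}"
  then have "H (-M) \<le> H x" "H x \<le> H M"
    by (auto intro: H_mono)
  then show "H x \<in> {- max \<bar>H (-M)\<bar> \<bar>H M\<bar>..max \<bar>H (-M)\<bar> \<bar>H M\<bar>}"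
    by auto
qed

text \<open>\<open>H\<close> maps a bounded interval into a bounded one, where the lower slope bound
  \<open>l\<close> of \<open>h\<close> becomes the Lipschitz constant \<open>1 / l\<close> of its
  inverse.\<close>

lemma H_Lipschitz: "\<exists>L. \<forall>x\<in>{-M..M}. \<forall>y\<in>{-M..M}. \<bar>H x - H y\<bar> \<le> L * \<bar>x - y\<bar>"
proof -
  obtain K where K: "\<And>x. x \<in> {-M..M} \<Longrightarrow> H x \<in> {-K..K}"
    using H_bounded_range by blast
  obtain l L where "0 < l" and l: "\<And>a b. -K \<le> a \<Longrightarrow> a \<le> b \<Longrightarrow> b \<le> K \<Longrightarrow>
      l * (b - a) \<le> h b - h a \<and> h b - h a \<le> L * (b - a)"
    by (rule slopes[of K]) blast
  have *: "\<bar>H x - H y\<bar> \<le> 1 / l * \<bar>x - y\<bar>" if "x \<in> {-M..M}" "y \<in> {-M..M}" "y \<le> x" for x y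
  proof -
    have "H y \<le> H x" by (rule H_mono[OF that(3)])
    then have "l * (H x - H y) \<le> x - y"
      using l[of "H y" "H x"] K[OF that(1)] K[OF that(2)] by simp
    then show ?thesis
      using \<open>0 < l\<close> \<open>H y \<le> H x\<close> that(3) by (simp add: field_simps)
  qed
  have "\<bar>H x - H y\<bar> \<le> 1 / l * \<bar>x - y\<bar>" if "x \<in> {-M..M}" "y \<in> {-M..M}" for x y
    using *[OF that] *[OF that(2,1)] by (cases "y \<le> x") (simp_all add: abs_minus_commute)
  then show ?thesis by blast
qed

lemma H_isCont: "isCont H x"
proof -
  obtain L where L: "\<And>a b. a \<in> {-(\<bar>x\<bar>+1)..\<bar>x\<bar>+1} \<Longrightarrow> b \<in> {-(\<bar>x\<bar>+1)..\<bar>x\<bar>+1} \<Longrightarrow> \<bar>H a - H b\<bar> \<le> L * \<bar>a - b\<bar>"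
    using H_Lipschitz[of "\<bar>x\<bar>+1"] by blast
  have "((\<lambda>y. L * \<bar>y - x\<bar>) \<longlongrightarrow> L * \<bar>x - x\<bar>) (at x)"
    by (intro tendsto_intros)
  then have lim: "((\<lambda>y. L * \<bar>y - x\<bar>) \<longlongrightarrow> 0) (at x)"
    by simp
  have "\<forall>\<^sub>F y in at x. norm (H y - H x) \<le> L * \<bar>y - x\<bar>"
    unfolding eventually_at by (rule exI[of _ 1]) (auto simp: dist_real_def intro!: L)
  then have "((\<lambda>y. H y - H x) \<longlongrightarrow> 0) (at x)"
    by (rule Lim_null_comparison[OF _ lim])
  then show ?thesis
    by (simp add: isCont_def LIM_zero_iff)
qed

lemma deriv_pos: "0 < h' x"
proof -
  obtain l where "0 < l" "\<And>y. y \<in> {-\<bar>x\<bar>..\<bar>x\<bar>} \<Longrightarrow> l \<le> h' y"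
    using deriv_bounds[of "\<bar>x\<bar>"] by blast
  from this(1) this(2)[of x] show ?thesis by force
qed

lemma H_has_derivative: "(H has_real_derivative inverse (h' (H x))) (at x)"
  by (rule DERIV_inverse_function[where f=h and a="x-1" and b="x+1"])
     (use deriv deriv_pos[of "H x"] H_isCont in auto)

text \<open>A derivative is a pointwise limit of continuous difference quotients. Measurability is
  what allows the derivative of \<open>H (U t)\<close> to be placed in
  \<open>L2_per T\<close>.\<close>

lemma deriv_measurable: "h' \<in> borel_measurable borel"
proof (rule borel_measurable_LIMSEQ_real)
  define e where "e k = 1 / real (Suc k)" for k
  have "e \<longlonglongrightarrow> 0"
    unfolding e_def by (rule LIMSEQ_Suc[OF lim_1_over_n])
  then have e: "filterlim e (at 0) sequentially"
    unfolding filterlim_at by (simp add: less_imp_neq[symmetric] eventually_sequentially e_def)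
  show "(\<lambda>k. (h (x + e k) - h x) / e k) \<longlonglongrightarrow> h' x" for x
    using deriv[of x] unfolding DERIV_def by (rule filterlim_compose[OF _ e])
  show "(\<lambda>x. (h (x + e k) - h x) / e k) \<in> borel_measurable borel" for k
    by (intro borel_measurable_continuous_onI continuous_intros continuous_on_compose2[OF continuous[of UNIV]])
       (auto simp: e_def)
qed

lemma algebraic_solution:
  assumes s: "s \<in> H1_per T" and "T > 0"
  obtains y where "y \<in> H1_per T" "AE t in lebesgue. h (y t) = s t"
proof -
  obtain U v where v: "v \<in> L2_per T" and U: "is_primitive U v" "AE t in lebesgue. s t = U t" "periodic T U"
    using H1_per_representative[OF s] by blast
  have contU: "continuous_on UNIV U"
    by (rule is_primitive_continuous[OF U(1)])
  have contH: "continuous_on UNIV (\<lambda>t. H (U t))"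
    by (rule continuous_on_compose2[of UNIV H, OF _ contU]) (auto intro: continuous_at_imp_continuous_on H_isCont)
  \<comment> \<open>This is \<open>H'\<close> along \<open>U\<close>. The range of \<open>U\<close>
    is bounded, so \<open>h'\<close> is bounded below by some \<open>l > 0\<close> at the points
    \<open>H (U t)\<close>, and multiplication by \<open>q\<close> preserves
    \<open>L2_per T\<close>.\<close>
  define q where "q t = inverse (h' (H (U t)))" for t
  obtain B where B: "\<And>t. \<bar>U t\<bar> \<le> B"
    using periodic_bounded[OF U(3) \<open>T > 0\<close> contU] by blast
  obtain K where K: "\<And>x. x \<in> {-B..B} \<Longrightarrow> H x \<in> {-K..K}"
    using H_bounded_range by blast
  obtain l where "0 < l" and l: "\<And>x. x \<in> {-K..K} \<Longrightarrow> l \<le> h' x"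
    using deriv_bounds[of K] by blast
  have "(\<lambda>t. q t * v t) \<in> L2_per T"
  proof (rule L2_per_bounded_mult[OF v])
    show "periodic T q"
      using U(3) by (simp add: periodic_def q_def)
    show "\<bar>q t\<bar> \<le> inverse l" for t
    proof -
      have "l \<le> h' (H (U t))"
        using B[of t] by (intro l K) (simp add: abs_le_iff)
      then show ?thesis
        using \<open>0 < l\<close> by (simp add: q_def)
    qed
    have "(\<lambda>t. h' (H (U t))) \<in> borel_measurable lebesgue"
      by (rule measurable_compose[OF continuous_borel_measurable_lebesgue[OF contH] deriv_measurable])
    then show "q \<in> borel_measurable lebesgue"
      unfolding q_def by simp
  qed
  moreover have "is_primitive (\<lambda>t. H (U t)) (\<lambda>t. q t * v t)"
    unfolding q_def by (rule is_primitive_compose_differentiable[OF U(1) H_has_derivative H_Lipschitz])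
  ultimately have "(\<lambda>t. H (U t)) \<in> H1_per T"
    using U(3) by (intro is_primitive_in_H1_per) (auto simp: periodic_def)
  moreover have "AE t in lebesgue. h (H (U t)) = s t"
    using U(2) by eventually_elim simp
  ultimately show ?thesis using that by blast
qed

end

section \<open>The periodic differential equation\<close>

text \<open>The periodic solution of \<open>u' + L u = p\<close> for continuous \<open>T\<close>-periodic \<open>p\<close>.\<close>
definition periodic_resolvent :: "real \<Rightarrow> real \<Rightarrow> (real \<Rightarrow> real) \<Rightarrow> real \<Rightarrow> real" where
  "periodic_resolvent L T p t = integral {0..T} (\<lambda>r. exp (L * r) * p (t + r)) / (exp (L * T) - 1)"

context
  fixes L T :: real
  assumes L: "L > 0" and T: "T > 0"
begin

lemma exp_period: "exp (L * T) > 1"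
  using L T by simp

lemma resolvent_integrable:
  assumes "continuous_on UNIV p"
  shows "(\<lambda>r. exp (L * r) * p (t + r)) integrable_on {0..T}"
  by (intro integrable_continuous_real continuous_intros continuous_on_compose2[OF assms]) auto

text \<open>The weight \<open>exp (L * r)\<close> integrates over a period to
  \<open>(exp (L * T) - 1) / L\<close>, which cancels the denominator up to
  \<open>1 / L\<close>.\<close>

lemma periodic_resolvent_bound:
  assumes p: "continuous_on UNIV p" and D: "\<And>t. \<bar>p t\<bar> \<le> D"
  shows "\<bar>periodic_resolvent L T p t\<bar> \<le> D / L"
proof -
  have "((\<lambda>r. exp (L * r)) has_integral (exp (L * T) / L - exp (L * 0) / L)) {0..T}"
    by (rule fundamental_theorem_of_calculus)
       (use L T in \<open>auto intro!: derivative_eq_intros simp flip: has_real_derivative_iff_has_vector_derivative\<close>)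
  then have int: "((\<lambda>r. exp (L * r) * D) has_integral ((exp (L * T) / L - exp (L * 0) / L) * D)) {0..T}"
    by (rule has_integral_mult_left)
  have "norm (integral {0..T} (\<lambda>r. exp (L * r) * p (t + r))) \<le> integral {0..T} (\<lambda>r. exp (L * r) * D)"
    by (intro integral_norm_bound_integral resolvent_integrable p)
       (use int D in \<open>auto simp: abs_mult has_integral_integrable intro!: mult_left_mono\<close>)
  also have "\<dots> = (exp (L * T) - 1) * (D / L)"
    unfolding integral_unique[OF int] by (simp add: left_diff_distrib diff_divide_distrib)
  finally show ?thesis
    using exp_period by (simp add: periodic_resolvent_def divide_le_eq mult.commute)
qed

lemma periodic_resolvent_diff:
  assumes "continuous_on UNIV p" "continuous_on UNIV q"
  shows "periodic_resolvent L T p t - periodic_resolvent L T q t = periodic_resolvent L T (\<lambda>t. p t - q t) t"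
  using Henstock_Kurzweil_Integration.integral_diff[OF resolvent_integrable[OF assms(1)] resolvent_integrable[OF assms(2)], of t t]
  by (simp add: periodic_resolvent_def right_diff_distrib diff_divide_distrib)

text \<open>For \<open>T\<close>-periodic \<open>p\<close> the quotient collapses to
  \<open>p t\<close>, and the formula becomes the equation \<open>u' = p - L u\<close>.\<close>

lemma periodic_resolvent_has_derivative:
  assumes p: "continuous_on UNIV p"
  shows "(periodic_resolvent L T p has_real_derivative
    (exp (L * T) * p (t + T) - p t) / (exp (L * T) - 1) - L * periodic_resolvent L T p t) (at t)"
proof -
  have "continuous_on UNIV (\<lambda>t. exp (L * t) * p t)"
    by (intro continuous_intros p)
  then obtain E where E: "\<And>t. (E has_real_derivative exp (L * t) * p t) (at t)"
    using continuous_has_antiderivative by blast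
  have E_shift: "((\<lambda>r. E (r + d)) has_real_derivative exp (L * (r + d)) * p (r + d)) (at r)" for r d
    using E[of "r + d"] by (simp only: DERIV_shift)
  \<comment> \<open>The integrating factor turns \<open>u' + L u = p\<close> into
    \<open>(exp (L t) u)' = E'\<close>; a periodic \<open>u\<close> then satisfies
    \<open>exp (L t) (exp (L T) - 1) u(t) = E (t + T) - E t\<close>.\<close>
  have eq: "periodic_resolvent L T p t = exp (- (L * t)) * (E (t + T) - E t) / (exp (L * T) - 1)" for t
  proof -
    have "((\<lambda>r. exp (L * r) * p (t + r)) has_integral
        (exp (- (L * t)) * E (T + t) - exp (- (L * t)) * E (0 + t))) {0..T}"
    proof (rule fundamental_theorem_of_calculus)
      fix r
      have "((\<lambda>r. exp (- (L * t)) * E (r + t)) has_real_derivative exp (- (L * t)) * (exp (L * (r + t)) * p (r + t))) (at r)"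
        by (rule DERIV_cmult[OF E_shift])
      moreover have "exp (- (L * t)) * exp (L * (r + t)) = exp (L * r)"
        by (simp add: mult_exp_exp distrib_left)
      then have "exp (- (L * t)) * (exp (L * (r + t)) * p (r + t)) = exp (L * r) * p (t + r)"
        by (simp only: mult.assoc[symmetric] add.commute)
      ultimately show "((\<lambda>r. exp (- (L * t)) * E (r + t)) has_vector_derivative exp (L * r) * p (t + r)) (at r within {0..T})"
        by (simp add: has_real_derivative_iff_has_vector_derivative has_vector_derivative_at_within)
    qed (use T in simp)
    then have "integral {0..T} (\<lambda>r. exp (L * r) * p (t + r)) = exp (- (L * t)) * (E (t + T) - E t)"
      by (simp add: integral_unique right_diff_distrib add.commute)
    then show ?thesis
      by (simp add: periodic_resolvent_def)
  qed
  let ?k = "exp (L * T) - 1"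
  have "((\<lambda>t. exp (- (L * t)) * (E (t + T) - E t) / ?k) has_real_derivative
     (exp (- (L * t)) * - L * (E (t + T) - E t)
       + (exp (L * (t + T)) * p (t + T) - exp (L * t) * p t) * exp (- (L * t))) / ?k) (at t)"
    by (intro DERIV_cdivide DERIV_mult DERIV_diff E E_shift) (auto intro!: derivative_eq_intros)
  moreover have "(exp (- (L * t)) * - L * (E (t + T) - E t)
       + (exp (L * (t + T)) * p (t + T) - exp (L * t) * p t) * exp (- (L * t))) / ?k
     = (exp (L * T) * p (t + T) - p t) / ?k - L * periodic_resolvent L T p t"
  proof -
    have e: "exp (L * (t + T)) * exp (- (L * t)) = exp (L * T)" "exp (L * t) * exp (- (L * t)) = 1"
      by (simp_all add: mult_exp_exp distrib_left)
    have "(exp (L * (t + T)) * p (t + T) - exp (L * t) * p t) * exp (- (L * t))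
        = (exp (L * (t + T)) * exp (- (L * t))) * p (t + T) - (exp (L * t) * exp (- (L * t))) * p t"
    proof -
      have "(a * P - b * Q) * c = (a * c) * P - (b * c) * Q" for a b c P Q :: real
        by (simp add: algebra_simps)
      then show ?thesis .
    qed
    then have "(exp (L * (t + T)) * p (t + T) - exp (L * t) * p t) * exp (- (L * t))
        = exp (L * T) * p (t + T) - p t"
      by (simp only: e mult_1)
    then show ?thesis
      by (simp only: eq add_divide_distrib) simp
  qed
  moreover have "periodic_resolvent L T p = (\<lambda>t. exp (- (L * t)) * (E (t + T) - E t) / ?k)"
    using eq by (rule ext)
  ultimately show ?thesis by (simp only:)
qed

lemma periodic_resolvent_continuous:
  assumes "continuous_on UNIV p"
  shows "continuous_on S (periodic_resolvent L T p)"
  by (intro continuous_at_imp_continuous_on ballI DERIV_isCont[OF periodic_resolvent_has_derivative[OF assms]])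

text \<open>Written as \<open>u' + L u = p\<close> with \<open>p = L u + \<sigma> - k (u + S)\<close>, the equation is a fixed point problem
  for a contraction with factor \<open>(L - l) / L\<close>, since \<open>x \<mapsto> L x - k x\<close> has Lipschitz
  constant \<open>L - l\<close> and the resolvent has norm \<open>1 / L\<close>.\<close>
lemma periodic_solution_Lipschitz:
  fixes k S :: "real \<Rightarrow> real" and \<sigma> l :: real
  assumes l: "0 < l" "l \<le> L"
    and k: "\<And>x y. x \<le> y \<Longrightarrow> l * (y - x) \<le> k y - k x \<and> k y - k x \<le> L * (y - x)"
    and S: "periodic T S" "continuous_on UNIV S"
  obtains u where "periodic T u" "\<And>t. (u has_real_derivative (\<sigma> - k (u t + S t))) (at t)"
proof -
  have lip: "\<bar>(L * x - k x) - (L * y - k y)\<bar> \<le> (L - l) * \<bar>x - y\<bar>" for x y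
    using k[of x y] k[of y x] by (cases "x \<le> y") (auto simp: abs_if algebra_simps)
  have klip: "\<bar>k x - k y\<bar> \<le> L * \<bar>x - y\<bar>" for x y
  proof (cases "x \<le> y")
    case True
    then have "0 \<le> l * (y - x)" using l by simp
    with True k[of x y] show ?thesis by (simp add: abs_if)
  next
    case False
    then have "0 \<le> l * (x - y)" using l by simp
    with False k[of y x] show ?thesis by (simp add: abs_if)
  qed
  have contk: "continuous_on UNIV k"
    by (rule lipschitz_on_continuous_on[of L]) (use klip L in \<open>auto simp: lipschitz_on_def dist_real_def\<close>)
  define p where "p u t = L * u t + \<sigma> - k (u t + S t)" for u t
  have contp: "continuous_on UNIV (p u)" if "continuous_on UNIV u" for u
    unfolding p_def by (intro continuous_intros that S continuous_on_compose2[OF contk]) auto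
  have pdiff: "\<bar>p u t - p v t\<bar> \<le> (L - l) * \<bar>u t - v t\<bar>" for u v t
    using lip[of "u t + S t" "v t + S t"] by (simp add: p_def algebra_simps)
  obtain A where A: "\<And>t. \<bar>S t\<bar> \<le> A"
    using periodic_bounded[OF S(1) T S(2)] by blast
  define J where "J u = periodic_resolvent L T (p u)" for u
  have p0: "\<bar>p (\<lambda>_. 0) t\<bar> \<le> \<bar>\<sigma>\<bar> + \<bar>k 0\<bar> + L * A" for t
  proof -
    have "\<bar>k (S t) - k 0\<bar> \<le> L * A"
      using klip[of "S t" 0, unfolded diff_0_right] mult_left_mono[OF A[of t] less_imp_le[OF L]] by linarith
    then show ?thesis by (simp add: p_def)
  qed
  \<comment> \<open>Boundedness compares \<open>p u\<close> with its value at the zero function: the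
    difference is Lipschitz in \<open>u\<close>, and the remainder is \<open>p0\<close>.\<close>
  have bcont: "J (apply_bcontfun u) \<in> bcontfun" for u
  proof (rule bcontfun_normI)
    show "continuous_on UNIV (J u)"
      unfolding J_def by (intro periodic_resolvent_continuous contp) simp
    show "norm (J u t) \<le> ((L - l) * norm u + (\<bar>\<sigma>\<bar> + \<bar>k 0\<bar> + L * A)) / L" for t
      unfolding J_def real_norm_def
    proof (rule periodic_resolvent_bound[OF contp])
      fix t
      have "(L - l) * \<bar>u t\<bar> \<le> (L - l) * norm u"
        using norm_bounded[of u t] l by (simp add: mult_left_mono)
      then show "\<bar>p u t\<bar> \<le> (L - l) * norm u + (\<bar>\<sigma>\<bar> + \<bar>k 0\<bar> + L * A)"
        using pdiff[of u t "\<lambda>_. 0"] p0[of t] by simp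
    qed simp
  qed
  define \<Phi> where "\<Phi> u = Bcontfun (J (apply_bcontfun u))" for u
  have \<Phi>: "apply_bcontfun (\<Phi> u) = J (apply_bcontfun u)" for u
    unfolding \<Phi>_def by (rule Bcontfun_inverse[OF bcont])
  have "dist (\<Phi> u) (\<Phi> v) \<le> (L - l) / L * dist u v" for u v
  proof (rule dist_bound)
    fix t
    have "\<bar>periodic_resolvent L T (\<lambda>t. p u t - p v t) t\<bar> \<le> (L - l) * dist u v / L"
    proof (rule periodic_resolvent_bound)
      show "continuous_on UNIV (\<lambda>t. p u t - p v t)"
        by (intro continuous_on_diff contp) auto
      fix t
      have "(L - l) * \<bar>u t - v t\<bar> \<le> (L - l) * dist u v"
        using dist_bounded[of u t v] l by (intro mult_left_mono) (auto simp: dist_real_def)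
      then show "\<bar>p u t - p v t\<bar> \<le> (L - l) * dist u v"
        using pdiff[of u t v] by linarith
    qed
    then show "dist (\<Phi> u t) (\<Phi> v t) \<le> (L - l) / L * dist u v"
      by (simp add: \<Phi> J_def dist_real_def periodic_resolvent_diff contp)
  qed
  then have "\<exists>!u. \<Phi> u = u"
    using l L by (intro banach_fix_type[of "(L - l) / L"]) auto
  then obtain u where u: "\<Phi> u = u" and unique: "\<And>v. \<Phi> v = v \<Longrightarrow> v = u"
    by blast
  have fix_u: "apply_bcontfun u t = J u t" for t
    using \<Phi>[of u] u by simp
  \<comment> \<open>The contraction acts on all bounded continuous functions. Since \<open>S\<close>
    is periodic and the resolvent commutes with translations, the shift of the fixed point by
    \<open>T\<close> is again a fixed point, so uniqueness gives periodicity.\<close>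
  have "periodic T u"
  proof -
    have "(\<lambda>t. u (t + T)) \<in> bcontfun"
    proof (rule bcontfun_normI)
      show "continuous_on UNIV (\<lambda>t. u (t + T))"
        by (intro continuous_on_compose2[OF continuous_on_apply_bcontfun[of UNIV]] continuous_intros) auto
      show "norm (u (t + T)) \<le> norm u" for t
        by (rule norm_bounded)
    qed
    then obtain v where v: "(\<lambda>t. u (t + T)) = apply_bcontfun v"
      by (rule bcontfunE)
    have "p v r = p u (r + T)" for r
      using fun_cong[OF v, of r] periodicD[OF S(1), of r] by (simp add: p_def)
    then have "J v t = J u (t + T)" for t
      by (simp add: J_def periodic_resolvent_def add_ac)
    then have "J v t = v t" for t
      using fix_u[of "t + T"] fun_cong[OF v, of t] by simp
    then have "v = u"
      by (intro unique bcontfun_eqI) (simp add: \<Phi>)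
    with v show ?thesis
      unfolding periodic_def by metis
  qed
  moreover have "(apply_bcontfun u has_real_derivative (\<sigma> - k (u t + S t))) (at t)" for t
  proof -
    have contpu: "continuous_on UNIV (p u)"
      by (rule contp) simp
    have "p u (t + T) = p u t"
      using periodicD[OF \<open>periodic T u\<close>] periodicD[OF S(1)] by (simp add: p_def)
    then have "exp (L * T) * p u (t + T) - p u t = p u t * (exp (L * T) - 1)"
      by (simp add: algebra_simps)
    moreover have "exp (L * T) - 1 \<noteq> 0"
      using exp_period by linarith
    ultimately have "(exp (L * T) * p u (t + T) - p u t) / (exp (L * T) - 1) = p u t"
      by (metis nonzero_mult_div_cancel_right)
    then have "(J u has_real_derivative p u t - L * J u t) (at t)"
      using periodic_resolvent_has_derivative[OF contpu, of t] by (simp add: J_def)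
    moreover have "J u = apply_bcontfun u"
      by (rule ext) (rule fix_u[symmetric])
    ultimately have "(apply_bcontfun u has_real_derivative p u t - L * u t) (at t)"
      by (simp only:)
    then show ?thesis by (simp add: p_def algebra_simps)
  qed
  ultimately show ?thesis using that by blast
qed

end

context coercive_increasing
begin

text \<open>At an extremum of \<open>u\<close> the equation forces \<open>u + S = m\<close>, which bounds \<open>u + S\<close> independently of
  the behaviour of \<open>h\<close> far away; so \<open>h\<close> may be replaced by an affine function there.\<close>
lemma periodic_solution:
  assumes S: "periodic T S" "continuous_on UNIV S" and T: "T > 0"
  obtains u where "periodic T u" "\<And>t. (u has_real_derivative (h m - h (u t + S t)) / 2) (at t)"
proof -
  obtain A where A: "\<And>t. \<bar>S t\<bar> \<le> A"
    using periodic_bounded[OF S(1) T S(2)] by blast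
  \<comment> \<open>At an extremum \<open>x\<close> of \<open>u\<close> one has
    \<open>u x = m - S x\<close>; moving to any \<open>t\<close> adds \<open>S t\<close>, so two
    values of \<open>S\<close> enter the bound.\<close>
  define M where "M = \<bar>m\<bar> + 2 * A"
  have "0 \<le> A" using A[of 0] by simp
  then have m: "m \<in> {-M..M}" "0 \<le> M" by (auto simp: M_def)
  obtain l L where l: "0 < l" "l \<le> L"
    and sl: "\<And>x y. -M \<le> x \<Longrightarrow> x \<le> y \<Longrightarrow> y \<le> M \<Longrightarrow> l * (y - x) \<le> h y - h x \<and> h y - h x \<le> L * (y - x)"
    by (rule slopes[of M]) blast
  define cl where "cl x = max (-M) (min M x)" for x
  \<comment> \<open>Outside \<open>{-M..M}\<close> this continues \<open>h / 2\<close> with slope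
    \<open>l / 2\<close>, keeping all slopes between \<open>l / 2\<close> and \<open>L / 2\<close>.
    The halves come from dividing the equation by \<open>1 + c = 2\<close>.\<close>
  define k where "k x = (h (cl x) + l * (x - cl x)) / 2" for x
  have k_eq: "k x = h x / 2" if "x \<in> {-M..M}" for x
    using that by (simp add: k_def cl_def)
  have k: "l / 2 * (y - x) \<le> k y - k x \<and> k y - k x \<le> L / 2 * (y - x)" if "x \<le> y" for x y
  proof -
    have cl: "-M \<le> cl x" "cl x \<le> cl y" "cl y \<le> M" "0 \<le> (y - cl y) - (x - cl x)"
      using that m(2) by (auto simp: cl_def)
    have "l * ((y - cl y) - (x - cl x)) \<le> L * ((y - cl y) - (x - cl x))"
      by (rule mult_right_mono[OF l(2) cl(4)])
    with sl[OF cl(1-3)] show ?thesis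
      by (simp add: k_def field_simps)
  qed
  obtain u where u: "periodic T u" "\<And>t. (u has_real_derivative (h m / 2 - k (u t + S t))) (at t)"
    by (rule periodic_solution_Lipschitz[of "L / 2" T "l / 2" k S "h m / 2"]) (use l k S T in auto)
  have contu: "continuous_on UNIV u"
    by (intro continuous_at_imp_continuous_on ballI DERIV_isCont[OF u(2)])
  have critical: "u x + S x = m" if "h m / 2 - k (u x + S x) = 0" for x
  proof -
    have eq: "k (u x + S x) = k m" using that m by (simp add: k_eq)
    have "\<bar>b - a\<bar> \<le> 0" if "k a = k b" "a \<le> b" for a b
      using k[OF that(2)] that l(1) by (simp add: mult_le_0_iff)
    from this[of "u x + S x" m] this[of m "u x + S x"] eq show ?thesis by linarith
  qed
  have upper: "u t + S t \<le> M" for t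
  proof -
    obtain x where x: "\<And>t. u t \<le> u x"
      using periodic_attains_sup[OF u(1) T contu] by blast
    have "h m / 2 - k (u x + S x) = 0"
      by (rule DERIV_local_max[OF u(2), of 1]) (auto intro: x)
    then have "u x + S x = m" by (rule critical)
    with x[of t] A[of t] A[of x] show ?thesis by (simp add: M_def)
  qed
  have lower: "- M \<le> u t + S t" for t
  proof -
    have "periodic T (\<lambda>t. - u t)" "continuous_on UNIV (\<lambda>t. - u t)"
      using u(1) contu by (auto simp: periodic_def intro: continuous_intros)
    then obtain x where x: "\<And>t. - u t \<le> - u x"
      using periodic_attains_sup[OF _ T] by blast
    have "h m / 2 - k (u x + S x) = 0"
      by (rule DERIV_local_min[OF u(2), of 1]) (use x in auto)
    then have "u x + S x = m" by (rule critical)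
    with x[of t] A[of t] A[of x] show ?thesis by (simp add: M_def)
  qed
  have "(u has_real_derivative (h m - h (u t + S t)) / 2) (at t)" for t
    using u(2)[of t] k_eq[of "u t + S t"] upper[of t] lower[of t] by (simp add: diff_divide_distrib)
  with u(1) that show ?thesis by blast
qed

lemma ode_solution:
  assumes s: "s \<in> L2_per T" and T: "T > 0"
  obtains y v where "is_primitive y v" "periodic T y" "v \<in> L2_per T" "\<And>t. 2 * v t + h (y t) = s t"
proof -
  have sint: "s integrable_on {0..T}"
    using L2_per_locally_integrable[OF s T] by (simp add: locally_integrable_def absolutely_integrable_on_def)
  \<comment> \<open>Only a mean-free function has a periodic primitive. Writing the mean as a value
    of \<open>h\<close> makes \<open>m\<close> the level that \<open>u + S\<close> takes at the
    extrema of \<open>u\<close>.\<close>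
  obtain m where m: "h m = integral {0..T} s / T"
    using surjective by blast
  define p where "p t = 1 / 2 * (s t - h m)" for t
  have "(\<lambda>t. h m) \<in> L2_per T"
    by (rule continuous_periodic_in_L2_per) (auto simp: periodic_def)
  then have "p \<in> L2_per T"
    unfolding p_def by (intro L2_per_bounded_mult[where B="1/2"] L2_per_diff s) (auto simp: periodic_def)
  then obtain S where S: "is_primitive S p"
    using locally_integrable_has_primitive[OF L2_per_locally_integrable[OF _ T]] by blast
  have "(p has_integral (1 / 2 * (integral {0..T} s - T * h m))) {0..T}"
    unfolding p_def using has_integral_const_real[of "h m" 0 T] T
    by (intro has_integral_mult_right has_integral_diff integrable_integral sint) simp
  then have "integral {0..T} p = 0"
    using T by (simp add: integral_unique m)
  then have perS: "periodic T S"
    by (rule is_primitive_periodic[OF S L2_per_periodic[OF \<open>p \<in> L2_per T\<close>] _ T])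
  have contS: "continuous_on UNIV S"
    by (rule is_primitive_continuous[OF S])
  obtain u where u: "periodic T u" "\<And>t. (u has_real_derivative (h m - h (u t + S t)) / 2) (at t)"
    by (rule periodic_solution[OF perS contS T, of m]) blast
  have contu: "continuous_on UNIV u"
    by (intro continuous_at_imp_continuous_on ballI DERIV_isCont[OF u(2)])
  define y where "y t = u t + S t" for t
  have pery: "periodic T y"
    using u(1) perS by (simp add: periodic_def y_def)
  have conth: "continuous_on UNIV (\<lambda>t. h (y t))"
    unfolding y_def by (intro continuous_on_compose2[OF continuous[of UNIV]] continuous_intros contu contS) auto
  have "is_primitive u (\<lambda>t. (h m - h (y t)) / 2)"
    unfolding y_def by (rule C1_is_primitive[OF u(2)]) (use conth in \<open>auto simp: y_def intro!: continuous_intros\<close>)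
  from is_primitive_add[OF this S]
  have "is_primitive y (\<lambda>t. (h m - h (y t)) / 2 + p t)"
    by (simp add: y_def[abs_def])
  moreover have "(\<lambda>t. (h m - h (y t)) / 2 + p t) = (\<lambda>t. 1 / 2 * (s t - h (y t)))"
    by (auto simp: p_def field_simps)
  ultimately have prim: "is_primitive y (\<lambda>t. 1 / 2 * (s t - h (y t)))"
    by simp
  have "(\<lambda>t. h (y t)) \<in> L2_per T"
    using pery conth by (intro continuous_periodic_in_L2_per) (auto simp: periodic_def)
  then have "(\<lambda>t. 1 / 2 * (s t - h (y t))) \<in> L2_per T"
    by (intro L2_per_bounded_mult[where B="1/2"] L2_per_diff s) (auto simp: periodic_def)
  then show ?thesis
    by (rule that[OF prim pery]) (simp add: field_simps)
qed

text \<open>The square of the difference of two solutions is periodic, so its derivative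
  \<open>- (y - z) (h y - h z) \<le> 0\<close> has integral zero over a period.\<close>
lemma ode_unique:
  assumes y: "is_primitive y v" "periodic T y" and z: "is_primitive z w" "periodic T z"
    and eq: "AE t in lebesgue. 2 * v t + h (y t) = 2 * w t + h (z t)" and T: "T > 0"
  shows "y t = z t"
proof -
  define d where "d t = y t - z t" for t
  define e where "e t = d t * (h (y t) - h (z t))" for t
  have perd: "periodic T d"
    using y z by (simp add: periodic_def d_def)
  have prim: "is_primitive d (\<lambda>t. v t - w t)"
    unfolding d_def by (rule is_primitive_diff[OF y(1) z(1)])
  have "((\<lambda>t. d t * (v t - w t) + (v t - w t) * d t) has_integral (d T * d T - d 0 * d 0)) {0..T}"
    using T by (intro is_primitive_has_integral[OF is_primitive_mult[OF prim prim]]) simp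
  then have "((\<lambda>t. d t * (v t - w t) + (v t - w t) * d t) has_integral 0) {0..T}"
    using periodicD[OF perd, of 0] by simp
  then have int: "((\<lambda>t. - (d t * (v t - w t) + (v t - w t) * d t)) has_integral 0) {0..T}"
    by (rule has_integral_neg[where k=0, unfolded minus_zero])
  obtain N where N: "negligible N" "{t. \<not> 2 * v t + h (y t) = 2 * w t + h (z t)} \<subseteq> N"
    using eq unfolding eventually_ae_filter_negligible by blast
  \<comment> \<open>The equations identify \<open>e\<close> with minus the derivative of
    \<open>d t * d t\<close> off a null set, which the integral ignores.\<close>
  have "(e has_integral 0) {0..T}"
  proof (rule has_integral_spike[OF N(1) _ int])
    fix t assume "t \<in> {0..T} - N"
    then have diff: "h (y t) - h (z t) = - 2 * (v t - w t)"
    proof -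
      have "2 * v t + h (y t) = 2 * w t + h (z t)"
        using N(2) \<open>t \<in> {0..T} - N\<close> by blast
      then show ?thesis by (simp add: algebra_simps)
    qed
    show "e t = - (d t * (v t - w t) + (v t - w t) * d t)"
      unfolding e_def diff by (simp add: algebra_simps)
  qed
  then have "integral {0..T} e = 0"
    by (rule integral_unique)
  moreover have "continuous_on {0..T} e"
    unfolding e_def d_def
    by (intro continuous_intros is_primitive_continuous[OF y(1)] is_primitive_continuous[OF z(1)]
        continuous_on_compose2[OF continuous[of UNIV]]) auto
  moreover have nonneg: "0 \<le> e t" for t
    using less_iff[of "y t" "z t"] less_iff[of "z t" "y t"]
    by (cases "y t" "z t" rule: linorder_cases) (auto simp: e_def d_def zero_le_mult_iff)
  \<comment> \<open>Continuity upgrades the vanishing integral of a nonnegative function to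
    vanishing at every point; injectivity of \<open>h\<close> then gives
    \<open>d r = 0\<close>.\<close>
  ultimately have "\<forall>r\<in>{0..T}. e r = 0"
    using integral_eq_0_iff[of 0 T e] T by simp
  then have "d r = 0" if "r \<in> {0..T}" for r
    using that by (auto simp: e_def d_def eq_iff)
  then have "d t = 0"
    using periodic_representative[OF perd T, of t] by metis
  then show ?thesis by (simp add: d_def)
qed

end

section \<open>The delay equation\<close>

text \<open>The bound on \<open>g'\<close> squeezes the slope between
  \<open>(1 - \<gamma>) f'\<close> and \<open>2 f'\<close>, and the continuous positive
  \<open>f'\<close> has a positive minimum and a maximum on a compact interval. The bound on
  \<open>g\<close> leaves at least the fraction \<open>1 - \<gamma>\<close> of the growth of
  \<open>f\<close>.\<close>

lemma coercive_increasing_add: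
  fixes f g :: "real \<Rightarrow> real"
  assumes f: "f C1_differentiable_on UNIV" and f_pos: "\<And>x. deriv f x > 0"
    and g: "\<And>x. g differentiable (at x)"
    and \<gamma>: "0 \<le> \<gamma>" "\<gamma> < 1"
    and gf: "\<And>x. \<bar>g x\<bar> \<le> \<gamma> * \<bar>f x\<bar>"
    and gf': "\<And>x. \<bar>deriv g x\<bar> \<le> \<gamma> * \<bar>deriv f x\<bar>"
    and f_top: "filterlim f at_top at_top" and f_bot: "filterlim f at_bot at_bot"
  shows "coercive_increasing (\<lambda>x. f x + g x) (\<lambda>x. deriv f x + deriv g x)"
proof
  obtain D where D: "\<And>x. (f has_real_derivative D x) (at x)" "continuous_on UNIV D"
    using f unfolding C1_differentiable_on_def
    by (auto simp: has_real_derivative_iff_has_vector_derivative)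
  have D_eq: "D = deriv f"
    using DERIV_imp_deriv[OF D(1)] by auto
  have cont: "continuous_on S (deriv f)" for S
    using continuous_on_subset[OF D(2) subset_UNIV] by (simp add: D_eq)
  have g': "(g has_real_derivative deriv g x) (at x)" for x
    using g[of x] by (simp add: DERIV_deriv_iff_real_differentiable)
  show "((\<lambda>x. f x + g x) has_real_derivative deriv f x + deriv g x) (at x)" for x
    using DERIV_add[OF D(1) g'] by (simp add: D_eq)
  show "\<exists>l>0. \<exists>L. \<forall>x\<in>{-M..M}. l \<le> deriv f x + deriv g x \<and> deriv f x + deriv g x \<le> L" for M
  proof (cases "M \<ge> 0")
    case True
    then have ne: "{-M..M} \<noteq> {}" by simp
    obtain a where a: "\<And>x. x \<in> {-M..M} \<Longrightarrow> deriv f a \<le> deriv f x"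
      using continuous_attains_inf[OF compact_Icc ne cont] by blast
    obtain b where b: "\<And>x. x \<in> {-M..M} \<Longrightarrow> deriv f x \<le> deriv f b"
      using continuous_attains_sup[OF compact_Icc ne cont] by blast
    have "(1 - \<gamma>) * deriv f a \<le> deriv f x + deriv g x \<and> deriv f x + deriv g x \<le> 2 * deriv f b"
      if "x \<in> {-M..M}" for x
    proof -
      have "\<bar>deriv g x\<bar> \<le> \<gamma> * deriv f x"
        using gf'[of x] f_pos[of x] by simp
      moreover have "(1 - \<gamma>) * deriv f a \<le> (1 - \<gamma>) * deriv f x"
        using a[OF that] \<gamma> by (intro mult_left_mono) auto
      moreover have "\<gamma> * deriv f x \<le> 1 * deriv f x"
        using \<gamma> f_pos[of x] by (intro mult_right_mono) auto
      ultimately show ?thesis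
        using b[OF that] by (simp add: left_diff_distrib abs_le_iff)
    qed
    moreover have "0 < (1 - \<gamma>) * deriv f a"
      using \<gamma> f_pos by simp
    ultimately show ?thesis by blast
  next
    case False
    then show ?thesis by (intro exI[of _ 1]) auto
  qed
  show "filterlim (\<lambda>x. f x + g x) at_top at_top"
  proof (rule filterlim_at_top_mono)
    show "filterlim (\<lambda>x. (1 - \<gamma>) * f x) at_top at_top"
      using \<gamma> by (intro filterlim_tendsto_pos_mult_at_top[OF tendsto_const _ f_top]) simp
    have "\<forall>\<^sub>F x in at_top. 0 \<le> f x"
      using f_top by (simp add: filterlim_at_top)
    then show "\<forall>\<^sub>F x in at_top. (1 - \<gamma>) * f x \<le> f x + g x"
    proof eventually_elim
      case (elim x)
      with gf[of x] show ?case by (simp add: left_diff_distrib abs_le_iff)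
    qed
  qed
  show "filterlim (\<lambda>x. f x + g x) at_bot at_bot"
  proof -
    have "filterlim (\<lambda>x. (1 - \<gamma>) * - f x) at_top at_bot"
      using \<gamma> f_bot by (intro filterlim_tendsto_pos_mult_at_top[OF tendsto_const])
        (simp_all add: filterlim_uminus_at_bot)
    moreover have "\<forall>\<^sub>F x in at_bot. (1 - \<gamma>) * - f x \<le> - (f x + g x)"
    proof -
      have "\<forall>\<^sub>F x in at_bot. f x \<le> 0"
        using f_bot by (simp add: filterlim_at_bot)
      then show ?thesis
      proof eventually_elim
        case (elim x)
        with gf[of x] show ?case by (simp add: left_diff_distrib abs_le_iff)
      qed
    qed
    ultimately have "filterlim (\<lambda>x. - (f x + g x)) at_top at_bot"
      by (rule filterlim_at_top_mono)
    then show "filterlim (\<lambda>x. f x + g x) at_bot at_bot"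
      by (simp only: filterlim_uminus_at_bot)
  qed
qed

theorem theorem5:
  fixes c T \<gamma> :: real and n :: nat and f g :: "real \<Rightarrow> real"
  assumes "c \<in> {-1, 1}"
    and "f C1_differentiable_on UNIV"
    and "\<And>x. deriv f x > 0"
    and "f 0 = 0"
    and "\<And>x. g differentiable (at x)"
    and "0 \<le> \<gamma>" and "\<gamma> < 1"
    and "\<And>x. \<bar>g x\<bar> \<le> \<gamma> * \<bar>f x\<bar>"
    and "\<And>x. \<bar>deriv g x\<bar> \<le> \<gamma> * \<bar>deriv f x\<bar>"
    and "filterlim f at_top at_top"
    and "filterlim f at_bot at_bot"
    and "T > 0" and "n \<ge> 1" and "real n * T = 1"
  shows "(\<forall>s \<in> H1_per T. \<exists>y \<in> H1_per T.
            solves_delay c f g s y \<and>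
            (\<forall>z \<in> H1_per T. solves_delay c f g s z \<longrightarrow> (AE t in lebesgue. z t = y t)) \<and>
            solves_ode c f g s y)
       \<and> (c = 1 \<longrightarrow>
          (\<forall>s \<in> L2_per T. \<exists>y \<in> H1_per T.
            solves_delay c f g s y \<and>
            (\<forall>z \<in> H1_per T. solves_delay c f g s z \<longrightarrow> (AE t in lebesgue. z t = y t)) \<and>
            solves_ode c f g s y))"
proof -
  note T = \<open>T > 0\<close>
  define h where "h x = f x + g x" for x
  interpret coercive_increasing h "\<lambda>x. deriv f x + deriv g x"
    unfolding h_def by (rule coercive_increasing_add[OF assms(2,3,5-11)])
  note delay_iff = solves_delay_iff_solves_ode[OF _ \<open>real n * T = 1\<close>]
  \<comment> \<open>The repeated conjunct is what the delay equation becomes under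
    \<open>delay_iff\<close>, so the statement has the shape of the goal after rewriting.\<close>
  have minus: "\<exists>y\<in>H1_per T. solves_ode (-1) f g s y \<and>
      (\<forall>z\<in>H1_per T. solves_ode (-1) f g s z \<longrightarrow> (AE t in lebesgue. z t = y t)) \<and>
      solves_ode (-1) f g s y"
    if s: "s \<in> H1_per T" for s
  proof -
    have ode: "solves_ode (-1) f g s z \<longleftrightarrow> (AE t in lebesgue. h (z t) = s t)" for z
      by (simp add: solves_ode_def h_def)
    obtain y where y: "y \<in> H1_per T" "AE t in lebesgue. h (y t) = s t"
      using algebraic_solution[OF s T] by blast
    have "AE t in lebesgue. z t = y t" if "AE t in lebesgue. h (z t) = s t" for z
      using y(2) that by eventually_elim (metis eq_iff)
    with y show ?thesis
      by (auto simp: ode)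
  qed
  have plus: "\<exists>y\<in>H1_per T. solves_ode 1 f g s y \<and>
      (\<forall>z\<in>H1_per T. solves_ode 1 f g s z \<longrightarrow> (AE t in lebesgue. z t = y t)) \<and>
      solves_ode 1 f g s y"
    if s: "s \<in> L2_per T" for s
  proof -
    have ode: "solves_ode 1 f g s z \<longleftrightarrow> (AE t in lebesgue. 2 * w t + h (z t) = s t)"
      if "has_weak_deriv z w" for z w
      using solves_ode_iff[OF that, of 1 f g s] by (simp add: h_def add.assoc)
    obtain y v where y: "is_primitive y v" "periodic T y" "v \<in> L2_per T" "\<And>t. 2 * v t + h (y t) = s t"
      using ode_solution[OF s T] by blast
    have "AE t in lebesgue. z t = y t" if z: "z \<in> H1_per T" and sol: "solves_ode 1 f g s z" for z
    proof -
      \<comment> \<open>A competing weak solution is replaced by its continuous representative,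
        which satisfies the same equation with the same derivative \<open>w\<close>.\<close>
      obtain U w where U: "has_weak_deriv z w" "is_primitive U w" "AE t in lebesgue. z t = U t" "periodic T U"
        using H1_per_representative[OF z] by blast
      have "AE t in lebesgue. 2 * w t + h (z t) = s t"
        using sol ode[OF U(1)] by blast
      with U(3) have "AE t in lebesgue. 2 * v t + h (y t) = 2 * w t + h (U t)"
        by eventually_elim (simp add: y(4))
      then have "y t = U t" for t
        by (rule ode_unique[OF y(1,2) U(2,4) _ T])
      with U(3) show ?thesis by simp
    qed
    moreover have "y \<in> H1_per T"
      by (rule is_primitive_in_H1_per[OF y(1-3)])
    moreover have "solves_ode 1 f g s y"
      using y(4) by (simp add: ode[OF is_primitive_has_weak_deriv[OF y(1)]])
    ultimately show ?thesis by blast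
  qed
  \<comment> \<open>By this inclusion \<open>plus\<close> also covers the Sobolev sources in the
    case \<open>c = 1\<close>.\<close>
  have "H1_per T \<subseteq> L2_per T"
    by (auto simp: H1_per_def)
  then show ?thesis
    using assms(1) minus plus by (auto simp: delay_iff)
qed

end
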